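(* Let $p>1$ and $a,b,L>0$. Then: (I) The set $\Lambda^{a,b}_p(0,L)$ of Dirichlet eigenvalues of $-\Delta^{a,b}_p$ on $(0,L)$ is $$\Lambda^{a,b}_p(0,L)=\left\{\lambda^{a,b}_{k,p}(0,L):=\left(\frac{k(a+b)}{2}\right)^p\lambda_{1,p}(0,L):\ k\in\mathbb N\right\}=\left(\frac{a+b}{2}\right)^p\{\lambda_{k,p}(0,L):k\in\mathbb N\}.$$ (II) For $k\in\mathbb N$, a function $u\in W^{1,p}_0(0,L)$ is an eigenfunction of $-\Delta^{a,b}_p$ associated to $\lambda^{a,b}_{k,p}(0,L)$ if and only if either $u(t)=c\,\phi^{a,b}_p\!\left(\frac{kt}{L}\right)$ or $u(t)=c\,\phi^{a,b}_p\!\left(\frac{kt}{L}-1\right)$ for some constant $c>0$.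
   Context: For $p>1$, $a,b,L>0$, the asymmetric $p$-Laplacian $\Delta^{a,b}_p u=\big(a^p[(u')^+]^{p-1}-b^p[(u')^-]^{p-1}\big)'$ is understood weakly: $u\in W^{1,p}_0(0,L)$ is a weak solution of $-\Delta^{a,b}_p u=g$ in $(0,L)$ if $\int_0^L\big(a^p[(u')^+]^{p-1}-b^p[(u')^-]^{p-1}\big)\varphi'\,dt=\int_0^L g\varphi\,dt$ for all $\varphi\in W^{1,p}_0(0,L)$. Here $s^\pm=\max\{\pm s,0\}$. The Dirichlet spectrum is $\Lambda^{a,b}_p(0,L)=\{\lambda\in\mathbb R:$ the problem $-\Delta^{a,b}_p u=\lambda|u|^{p-2}u$ in $(0,L)$, $u(0)=u(L)=0$, has a nontrivial weak solution $u\in W^{1,p}_0(0,L)\}$; such $u$ are the eigenfunctions associated to $\lambda$. $\pi_p:=2\int_0^1(1-t^p)^{-1/p}dt$ and $\lambda_{k,p}(0,L):=(p-1)\left(\frac{k\pi_p}{L}\right)^p$ for $k\in\mathbb N$ (the Dirichlet eigenvalues of the classical $-\Delta_p u=-(|u'|^{p-2}u')'$ on $(0,L)$). $\varphi_p\in W^{1,p}_0(0,1)$ denotes the positive principal eigenfunction of $-\Delta_p$ on $(0,1)$ associated to $\lambda_{1,p}(0,1)$, normalized by $\|\varphi_p\|_{L^p}=1$. Let $t_0=\frac{a}{a+b}$. Define on $[0,1]$: $\varphi^{a,b,+}_p(t)=\varphi_p\!\left(\frac{t}{2t_0}\right)$ for $t\in[0,t_0)$, $\varphi^{a,b,+}_p(t)=\varphi_p\!\left(\frac{t+1-2t_0}{2(1-t_0)}\right)$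 for $t\in[t_0,1]$; $\varphi^{a,b,-}_p(t)=-\varphi_p\!\left(\frac{t}{2(1-t_0)}\right)$ for $t\in[0,1-t_0)$, $\varphi^{a,b,-}_p(t)=-\varphi_p\!\left(\frac{t+2t_0-1}{2t_0}\right)$ for $t\in[1-t_0,1]$. The $2$-periodic function $\phi^{a,b}_p:\mathbb R\to\mathbb R$ is defined by $\phi^{a,b}_p(t)=\varphi^{a,b,+}_p(t)$ for $t\in[0,1)$, $\phi^{a,b}_p(t)=\varphi^{a,b,-}_p(t-1)$ for $t\in[1,2]$, and $\phi^{a,b}_p(t+2)=\phi^{a,b}_p(t)$ for all $t\in\mathbb R$. *)

theory Defs
  imports "HOL-Analysis.Analysis"
begin

text \<open>Membership in W^{1,p}_0(0,L) in one dimension: u is (the continuous representative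
  of) a function on [0,L] with weak derivative u' in L^p(0,L), u(t) = integral of u'
  over [0,t], and u(L) = 0 (so u(0) = u(L) = 0). Values outside [0,L] are irrelevant.\<close>
definition W01p :: "real \<Rightarrow> real \<Rightarrow> (real \<Rightarrow> real) \<Rightarrow> (real \<Rightarrow> real) \<Rightarrow> bool" where
  "W01p p L u u' \<longleftrightarrow>
     u' \<in> borel_measurable lborel \<and>
     set_integrable lborel {0..L} u' \<and>
     set_integrable lborel {0..L} (\<lambda>t. \<bar>u' t\<bar> powr p) \<and>
     (\<forall>t\<in>{0..L}. u t = (LBINT s:{0..t}. u' s)) \<and>
     u L = 0"

text \<open>Weak formulation of  -Delta^{a,b}_p u = lam |u|^{p-2} u  in (0,L), u in W^{1,p}_0,
  with u' a weak derivative of u.\<close>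
definition weak_eig_eq ::
  "real \<Rightarrow> real \<Rightarrow> real \<Rightarrow> real \<Rightarrow> real \<Rightarrow> (real \<Rightarrow> real) \<Rightarrow> (real \<Rightarrow> real) \<Rightarrow> bool" where
  "weak_eig_eq p a b L lam u u' \<longleftrightarrow>
     (\<forall>v v'. W01p p L v v' \<longrightarrow>
        (LBINT t:{0..L}. (a powr p * (max (u' t) 0) powr (p - 1)
                          - b powr p * (max (- u' t) 0) powr (p - 1)) * v' t)
        = (LBINT t:{0..L}. lam * (\<bar>u t\<bar> powr (p - 2) * u t) * v t))"

definition is_eigenfunction ::
  "real \<Rightarrow> real \<Rightarrow> real \<Rightarrow> real \<Rightarrow> real \<Rightarrow> (real \<Rightarrow> real) \<Rightarrow> bool" where
  "is_eigenfunction p a b L lam u \<longleftrightarrow>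
     (\<exists>u'. W01p p L u u' \<and> weak_eig_eq p a b L lam u u') \<and> (\<exists>t\<in>{0..L}. u t \<noteq> 0)"

definition asym_spectrum :: "real \<Rightarrow> real \<Rightarrow> real \<Rightarrow> real \<Rightarrow> real set" where
  "asym_spectrum p a b L = {lam. \<exists>u. is_eigenfunction p a b L lam u}"

definition pi_p :: "real \<Rightarrow> real" where
  "pi_p p = 2 * (LBINT t:{0<..<1}. (1 - t powr p) powr (- 1 / p))"

definition lambda_kp :: "nat \<Rightarrow> real \<Rightarrow> real \<Rightarrow> real" where
  "lambda_kp k p L = (p - 1) * (real k * pi_p p / L) powr p"

text \<open>Positive principal eigenfunction of the classical -Delta_p on (0,1) (which is
  -Delta^{1,1}_p), normalized in L^p; set to 0 outside [0,1] to make it unique.\<close>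
definition varphi_p :: "real \<Rightarrow> real \<Rightarrow> real" where
  "varphi_p p = (THE u. is_eigenfunction p 1 1 1 (lambda_kp 1 p 1) u \<and>
                        (\<forall>t\<in>{0<..<1}. u t > 0) \<and>
                        (LBINT t:{0..1}. \<bar>u t\<bar> powr p) = 1 \<and>
                        (\<forall>t. t \<notin> {0..1} \<longrightarrow> u t = 0))"

definition t0_ab :: "real \<Rightarrow> real \<Rightarrow> real" where
  "t0_ab a b = a / (a + b)"

definition varphi_plus :: "real \<Rightarrow> real \<Rightarrow> real \<Rightarrow> real \<Rightarrow> real" where
  "varphi_plus p a b t =
     (if t < t0_ab a b then varphi_p p (t / (2 * t0_ab a b))
      else varphi_p p ((t + 1 - 2 * t0_ab a b) / (2 * (1 - t0_ab a b))))"

definition varphi_minus :: "real \<Rightarrow> real \<Rightarrow> real \<Rightarrow> real \<Rightarrow> real" where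
  "varphi_minus p a b t =
     (if t < 1 - t0_ab a b then - varphi_p p (t / (2 * (1 - t0_ab a b)))
      else - varphi_p p ((t + 2 * t0_ab a b - 1) / (2 * t0_ab a b)))"

definition phi_ab :: "real \<Rightarrow> real \<Rightarrow> real \<Rightarrow> real \<Rightarrow> real" where
  "phi_ab p a b t =
     (let s = t - 2 * of_int \<lfloor>t / 2\<rfloor> in
      if s < 1 then varphi_plus p a b s else varphi_minus p a b (s - 1))"

end

theory Submission
  imports Defs
begin

text \<open>
  By the fundamental lemma of the calculus of variations, the flux of a weak solution is
  continuously differentiable, so that eigenfunctions are the solutions with zero boundary values
  of a planar Hamiltonian system for \<open>u\<close> and its flux \<open>w\<close>. The
  energy \<open>(p - 1) N(u')^p + lam |u|^p\<close>, where \<open>N(s) = a s^+ + b s^-\<close>, is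
  conserved. Dividing \<open>u\<close> by its amplitude and applying the generalised arcsine turns the
  solution into a triangular wave: its slope is proportional to \<open>1/a\<close> while \<open>w > 0\<close> and
  to \<open>-1/b\<close> while \<open>w < 0\<close>, and at a turning point the sign of \<open>w'\<close>, hence the next
  branch, is forced by \<open>u \<noteq> 0\<close>. This gives uniqueness for the initial value problem although the
  system is not Lipschitz. All solutions starting at \<open>u = 0\<close> are therefore rescalings
  \<open>c \<phi>(\<omega> t)\<close> of one explicit 2-periodic wave, or of its half-period shift, and \<open>u(L) = 0\<close>
  forces \<open>\<omega> L\<close> to be an integer.
\<close>

section \<open>The asymmetric flux and the first-order system\<close>

text \<open>The flux serves as second variable because it is the quantity that the weak equation
  makes differentiable. Lipschitz continuity fails for p > 2 where u' is recovered from the flux,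
  and for p < 2 in the term |u|^(p-2) u. By homogeneity the period does not depend on the energy:
  the phase crosses an interval of length pi_p with speed (lam/(p-1))^(1/p)/a going up, and with b
  in place of a going down, so a full period lasts (a+b) pi_p ((p-1)/lam)^(1/p). This is the origin
  of a+b. A positive arch rises for a share a/(a+b) of its length and falls for the rest; a negative
  arch falls for b/(a+b) and then rises. Both arches are equally long, so the zeros are equally
  spaced and both initial signs give the same eigenvalues. Replacing (u, w) by (-u, -w) exchanges a
  and b, which reduces negative flux to positive flux. The wave is built from an inverse function
  and not from \<open>varphi_p\<close>; hence the classification with a = b = 1 can identify
  \<open>varphi_p\<close> without circularity.\<close>

lemma has_real_derivative_max_powr:
  fixes r x :: real
  assumes "r > 1"
  shows "((\<lambda>x. max x 0 powr r) has_real_derivative r * max x 0 powr (r - 1)) (at x)"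
proof -
  consider "x > 0" | "x < 0" | "x = 0" by linarith
  then show ?thesis
  proof cases
    case 1
    have "((\<lambda>x. x powr r) has_real_derivative r * x powr (r - 1)) (at x)"
      using 1 by (rule has_real_derivative_powr)
    then have "((\<lambda>x. max x 0 powr r) has_real_derivative r * x powr (r - 1)) (at x)"
      by (rule has_field_derivative_transform_within_open[where S = "{0<..}"]) (use 1 in auto)
    then show ?thesis using 1 by simp
  next
    case 2
    have "((\<lambda>x. 0) has_real_derivative 0) (at x)" by simp
    then have "((\<lambda>x. max x 0 powr r) has_real_derivative 0) (at x)"
      by (rule has_field_derivative_transform_within_open[where S = "{..<0}"]) (use 2 in auto)
    then show ?thesis using 2 by simp
  next
    case 3
    have lim: "((\<lambda>y::real. \<bar>y\<bar> powr (r - 1)) \<longlongrightarrow> 0) (at 0)"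
    proof -
      have "((\<lambda>y::real. \<bar>y\<bar> powr (r - 1)) \<longlongrightarrow> \<bar>0\<bar> powr (r - 1)) (at 0)"
        by (rule tendsto_powr2) (use assms in \<open>auto intro!: tendsto_eq_intros\<close>)
      then show ?thesis by simp
    qed
    have "((\<lambda>y. (max y 0 powr r - max 0 0 powr r) / (y - 0)) \<longlongrightarrow> 0) (at 0)"
    proof (rule Lim_null_comparison[OF _ lim])
      show "\<forall>\<^sub>F y in at 0. norm ((max y 0 powr r - max 0 0 powr r) / (y - 0)) \<le> \<bar>y\<bar> powr (r - 1)"
      proof (rule always_eventually, rule allI)
        fix y :: real
        show "norm ((max y 0 powr r - max 0 0 powr r) / (y - 0)) \<le> \<bar>y\<bar> powr (r - 1)"
          by (cases "y > 0") (auto simp: powr_diff divide_nonneg_nonpos)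
      qed
    qed
    then show ?thesis
      using 3 by (simp add: has_field_derivative_iff)
  qed
qed

lemma abs_powr_eq_max_powr:
  fixes x r :: real
  shows "\<bar>x\<bar> powr r = max x 0 powr r + max (- x) 0 powr r"
  by (cases "x \<ge> 0") (auto simp: max_def)

text \<open>For p < 2 the factor \<open>\<bar>x\<bar> powr (p - 2)\<close> blows up at 0. On the
  right the exponent is positive once p > 1, so continuity and derivatives need no case distinction
  at p = 2. At x = 0 both sides are 0 because \<open>0 powr r = 0\<close>.\<close>

lemma odd_powr_eq_max_powr:
  fixes x p :: real
  shows "\<bar>x\<bar> powr (p - 2) * x = max x 0 powr (p - 1) - max (- x) 0 powr (p - 1)"
proof -
  have "y powr (p - 2) * y = y powr (p - 1)" if "y > 0" for y :: real
    using that powr_add[of y "p - 2" 1] by (simp add: add.commute)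
  from this[of x] this[of "-x"] show ?thesis
    by (cases x "0::real" rule: linorder_cases) (auto simp: max_def)
qed

lemma has_real_derivative_abs_powr:
  fixes p x :: real
  assumes "p > 1"
  shows "((\<lambda>x. \<bar>x\<bar> powr p) has_real_derivative p * (\<bar>x\<bar> powr (p - 2) * x)) (at x)"
proof -
  have "((\<lambda>x. max x 0 powr p + max (- x) 0 powr p) has_real_derivative
      p * max x 0 powr (p - 1) + (p * max (- x) 0 powr (p - 1)) * (- 1)) (at x)"
    by (intro DERIV_add has_real_derivative_max_powr[OF assms]
        DERIV_chain2[where g = uminus, OF has_real_derivative_max_powr[OF assms]])
       (auto intro!: derivative_eq_intros)
  then show ?thesis
    unfolding abs_powr_eq_max_powr[symmetric] odd_powr_eq_max_powr by (simp add: algebra_simps)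
qed

lemma continuous_on_odd_powr:
  fixes f :: "'a::topological_space \<Rightarrow> real"
  assumes "p > 1" and "continuous_on A f"
  shows "continuous_on A (\<lambda>t. \<bar>f t\<bar> powr (p - 2) * f t)"
  unfolding odd_powr_eq_max_powr
  by (intro continuous_intros continuous_on_powr' assms) (use assms in auto)

definition asym_flux :: "real \<Rightarrow> real \<Rightarrow> real \<Rightarrow> real \<Rightarrow> real" where
  "asym_flux p a b s = a powr p * max s 0 powr (p - 1) - b powr p * max (- s) 0 powr (p - 1)"

text \<open>The inverse of \<open>asym_flux\<close>: for s > 0 and w = a^p s^(p-1) one has w/a = (a
  s)^(p-1). Keeping w/a as the base matches the form of the energy below.\<close>

definition flux_inv :: "real \<Rightarrow> real \<Rightarrow> real \<Rightarrow> real \<Rightarrow> real" where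
  "flux_inv p a b w =
     (max w 0 / a) powr (1 / (p - 1)) / a - (max (- w) 0 / b) powr (1 / (p - 1)) / b"

lemma powr_inverse_cancel:
  fixes x r :: real
  assumes "r > 0" "x \<ge> 0"
  shows "(x powr r) powr (1 / r) = x" "(x powr (1 / r)) powr r = x"
  using assms by (auto simp: powr_powr)

lemma powr_base_inject:
  fixes x y r :: real
  assumes "r > 0" "x \<ge> 0" "y \<ge> 0" "x powr r = y powr r"
  shows "x = y"
  using assms powr_inverse_cancel(1) by metis

lemma powr_pred: "(a::real) > 0 \<Longrightarrow> a powr p / a = a powr (p - 1)"
  by (simp add: powr_diff)

lemma flux_inv_asym_flux:
  assumes "p > 1" "a > 0" "b > 0"
  shows "flux_inv p a b (asym_flux p a b s) = s"
proof -
  have key: "(c powr p * y powr (p - 1) / c) powr (1 / (p - 1)) / c = y" if "c > 0" "y \<ge> 0" for c y :: real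
  proof -
    have "c powr p * y powr (p - 1) / c = (c * y) powr (p - 1)"
      using that powr_pred[of c p, symmetric] by (simp add: powr_mult)
    then show ?thesis using that powr_inverse_cancel(1)[of "p - 1" "c * y"] assms(1) by simp
  qed
  show ?thesis
    using key[of a s] key[of b "- s"] assms
    by (cases "s \<ge> 0") (auto simp: flux_inv_def asym_flux_def max_def mult_le_0_iff)
qed

lemma asym_flux_flux_inv:
  assumes "p > 1" "a > 0" "b > 0"
  shows "asym_flux p a b (flux_inv p a b w) = w"
proof -
  have key: "c powr p * ((y / c) powr (1 / (p - 1)) / c) powr (p - 1) = y" if "c > 0" "y \<ge> 0" for c y :: real
  proof -
    have "((y / c) powr (1 / (p - 1)) / c) powr (p - 1) = (y / c) / c powr (p - 1)"
      using that assms powr_inverse_cancel(2)[of "p - 1" "y / c"] by (subst powr_divide) auto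
    then show ?thesis using that powr_pred[of c p] by (simp add: field_simps)
  qed
  show ?thesis
    using key[of a w] key[of b "- w"] assms
    by (cases w "0::real" rule: linorder_cases)
       (auto simp: flux_inv_def asym_flux_def max_def divide_le_0_iff)
qed

lemma flux_inv_minus: "flux_inv p b a (- w) = - flux_inv p a b w"
  by (simp add: flux_inv_def)

lemma flux_inv_0 [simp]: "flux_inv p a b 0 = 0"
  by (simp add: flux_inv_def)

lemma flux_inv_times_pos:
  assumes "a > 0" "b > 0" "w \<noteq> 0"
  shows "flux_inv p a b w * w > 0"
  using assms by (cases "w > 0")
    (auto simp: flux_inv_def max_def zero_less_mult_iff mult_less_0_iff divide_less_0_iff)

text \<open>Homogeneity of degree 1/(p-1), the source of the two-parameter family of rescaled
  waves.\<close>

lemma flux_inv_scale: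
  assumes "p > 1" "s > 0" "a > 0" "b > 0"
  shows "flux_inv p a b (s powr (p - 1) * w) = s * flux_inv p a b w"
proof -
  have *: "(s powr (p - 1) * y / c) powr (1 / (p - 1)) = s * (y / c) powr (1 / (p - 1))"
    if "y \<ge> 0" "c > 0" for y c :: real
    using that assms powr_inverse_cancel(1)[of "p - 1" s]
    by (simp add: powr_mult powr_divide)
  have "max (s powr (p - 1) * w) 0 = s powr (p - 1) * max w 0"
       "max (- (s powr (p - 1) * w)) 0 = s powr (p - 1) * max (- w) 0"
    using assms by (auto simp: max_def zero_le_mult_iff mult_le_0_iff)
  then show ?thesis
    using *[of "max w 0" a] *[of "max (- w) 0" b] assms
    by (simp add: flux_inv_def right_diff_distrib)
qed

lemma continuous_on_flux_inv:
  fixes w :: "'a::topological_space \<Rightarrow> real"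
  assumes "p > 1" "a > 0" "b > 0" "continuous_on A w"
  shows "continuous_on A (\<lambda>t. flux_inv p a b (w t))"
  unfolding flux_inv_def
  by (intro continuous_intros continuous_on_powr' assms) (use assms in auto)

text \<open>No boundary values are included, so that the same notion serves the initial value
  problem and the Dirichlet problem. Derivatives within \<open>{0..L}\<close> are one-sided at the
  ends, since values outside the interval are arbitrary.\<close>

definition asym_sol ::
  "real \<Rightarrow> real \<Rightarrow> real \<Rightarrow> real \<Rightarrow> real \<Rightarrow> (real \<Rightarrow> real) \<Rightarrow> (real \<Rightarrow> real) \<Rightarrow> bool" where
  "asym_sol p a b L lam u w \<longleftrightarrow> (\<forall>t\<in>{0..L}.
     (u has_real_derivative flux_inv p a b (w t)) (at t within {0..L}) \<and>
     (w has_real_derivative - lam * (\<bar>u t\<bar> powr (p - 2) * u t)) (at t within {0..L}))"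

text \<open>The symmetry that spares a separate treatment of negative flux.\<close>

lemma asym_sol_minus:
  assumes "asym_sol p a b L lam u w"
  shows "asym_sol p b a L lam (\<lambda>t. - u t) (\<lambda>t. - w t)"
  using assms unfolding asym_sol_def flux_inv_minus
  by (auto intro!: derivative_eq_intros)

lemma asym_sol_continuous:
  assumes "asym_sol p a b L lam u w"
  shows "continuous_on {0..L} u" "continuous_on {0..L} w"
  using assms unfolding asym_sol_def
  by (auto intro!: DERIV_continuous_on)

text \<open>This is p times the Hamiltonian of the system. For w > 0 the base \<open>w / a\<close>
  is (a u')^(p-1), so its power p/(p-1) is (a u')^p; likewise with b for w < 0.\<close>

definition asym_energy :: "real \<Rightarrow> real \<Rightarrow> real \<Rightarrow> real \<Rightarrow> real \<Rightarrow> real \<Rightarrow> real" where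
  "asym_energy p a b lam u w =
     (p - 1) * ((max w 0 / a) powr (p / (p - 1)) + (max (- w) 0 / b) powr (p / (p - 1)))
     + lam * \<bar>u\<bar> powr p"

lemma max_divide_pos: "(c::real) > 0 \<Longrightarrow> max w 0 / c = max (w / c) 0"
  by (auto simp: max_def divide_le_0_iff)

lemma asym_energy_const:
  assumes p: "p > 1" and ab: "a > 0" "b > 0" and sol: "asym_sol p a b L lam u w"
    and t: "t \<in> {0..L}"
  shows "asym_energy p a b lam (u t) (w t) = asym_energy p a b lam (u 0) (w 0)"
proof -
  \<comment> \<open>The conjugate exponent. It exceeds 1, so the positive-part powers are
    differentiable even where w = 0; \<open>r - 1\<close> is the exponent in
    \<open>flux_inv\<close>, and \<open>(p - 1) * r = p\<close> makes the two halves of the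
    derivative cancel.\<close>
  define r where "r = p / (p - 1)"
  have r: "r > 1" "r - 1 = 1 / (p - 1)" "(p - 1) * r = p" using p by (auto simp: r_def field_simps)
  have eq: "asym_energy p a b lam x y =
      (p - 1) * (max (y / a) 0 powr r + max (- y / b) 0 powr r) + lam * \<bar>x\<bar> powr p" for x y
    using ab max_divide_pos[of a y] max_divide_pos[of b "- y"] by (simp add: asym_energy_def r_def)
  have geq: "flux_inv p a b y = max (y / a) 0 powr (r - 1) / a - max (- y / b) 0 powr (r - 1) / b" for y
    using ab max_divide_pos[of a y] max_divide_pos[of b "- y"] by (simp add: flux_inv_def r)
  have "((\<lambda>t. asym_energy p a b lam (u t) (w t)) has_real_derivative 0) (at t within {0..L})"
    if t: "t \<in> {0..L}" for t
  proof -
    define ud where "ud = flux_inv p a b (w t)"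
    define wd where "wd = - lam * (\<bar>u t\<bar> powr (p - 2) * u t)"
    have du: "(u has_real_derivative ud) (at t within {0..L})"
     and dw: "(w has_real_derivative wd) (at t within {0..L})"
      using sol t by (auto simp: asym_sol_def ud_def wd_def)
    have d1: "((\<lambda>t. max (w t / a) 0 powr r) has_real_derivative
        r * max (w t / a) 0 powr (r - 1) * (wd / a)) (at t within {0..L})"
      by (rule DERIV_chain2[OF has_real_derivative_max_powr[OF r(1)]]) (rule DERIV_cdivide[OF dw])
    have d2: "((\<lambda>t. max (- w t / b) 0 powr r) has_real_derivative
        r * max (- w t / b) 0 powr (r - 1) * (- wd / b)) (at t within {0..L})"
      by (rule DERIV_chain2[OF has_real_derivative_max_powr[OF r(1)]])
         (rule DERIV_cdivide[OF DERIV_minus[OF dw]])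
    have d3: "((\<lambda>t. \<bar>u t\<bar> powr p) has_real_derivative
        p * (\<bar>u t\<bar> powr (p - 2) * u t) * ud) (at t within {0..L})"
      by (rule DERIV_chain2[OF has_real_derivative_abs_powr[OF p] du])
    have "((\<lambda>t. asym_energy p a b lam (u t) (w t)) has_real_derivative
       (p - 1) * (r * max (w t / a) 0 powr (r - 1) * (wd / a)
         + r * max (- w t / b) 0 powr (r - 1) * (- wd / b))
       + lam * (p * (\<bar>u t\<bar> powr (p - 2) * u t) * ud)) (at t within {0..L})"
      unfolding eq by (intro DERIV_add DERIV_cmult d1 d2 d3)
    also have "(p - 1) * (r * max (w t / a) 0 powr (r - 1) * (wd / a)
         + r * max (- w t / b) 0 powr (r - 1) * (- wd / b))
       + lam * (p * (\<bar>u t\<bar> powr (p - 2) * u t) * ud) =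
       ((p - 1) * r) * wd * flux_inv p a b (w t) + lam * (p * (\<bar>u t\<bar> powr (p - 2) * u t) * ud)"
      unfolding geq by (simp add: algebra_simps)
    also have "\<dots> = 0"
      unfolding r(3) wd_def ud_def by (simp add: algebra_simps)
    finally show ?thesis .
  qed
  then have "\<exists>c. \<forall>t\<in>{0..L}. asym_energy p a b lam (u t) (w t) = c"
    by (intro has_field_derivative_zero_constant) auto
  then show ?thesis using t by force
qed

section \<open>Integration by parts and the fundamental lemma\<close>

lemma set_integrable_continuous_mult:
  fixes K v :: "real \<Rightarrow> real"
  assumes K: "continuous_on {a..b} K" and v: "set_integrable lborel {a..b} v"
  shows "set_integrable lborel {a..b} (\<lambda>t. K t * v t)"
proof -
  have "bounded (K ` {a..b})"
    using K by (intro compact_imp_bounded compact_continuous_image) auto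
  then obtain B where "\<forall>y\<in>K ` {a..b}. norm y \<le> B"
    by (auto simp: bounded_iff)
  then have B: "\<And>t. t \<in> {a..b} \<Longrightarrow> \<bar>K t\<bar> \<le> B" by auto
  have mK: "(\<lambda>t. indicator {a..b} t *\<^sub>R K t) \<in> borel_measurable lborel"
    using borel_measurable_continuous_on_indicator[OF _ K] by simp
  have mv: "(\<lambda>t. indicator {a..b} t *\<^sub>R v t) \<in> borel_measurable lborel"
    using v unfolding set_integrable_def by (rule borel_measurable_integrable)
  have "integrable lborel (\<lambda>t. B * (indicator {a..b} t *\<^sub>R v t))"
    using v unfolding set_integrable_def by (rule integrable_mult_right)
  then have "integrable lborel (\<lambda>t. (indicator {a..b} t *\<^sub>R K t) * (indicator {a..b} t *\<^sub>R v t))"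
  proof (rule Bochner_Integration.integrable_bound)
    show "AE t in lborel. norm ((indicator {a..b} t *\<^sub>R K t) * (indicator {a..b} t *\<^sub>R v t))
        \<le> norm (B * (indicator {a..b} t *\<^sub>R v t))"
    proof (rule AE_I2)
      fix t :: real
      show "norm ((indicator {a..b} t *\<^sub>R K t) * (indicator {a..b} t *\<^sub>R v t))
        \<le> norm (B * (indicator {a..b} t *\<^sub>R v t))"
      proof (cases "t \<in> {a..b}")
        case True
        then have "\<bar>K t\<bar> \<le> \<bar>B\<bar>" using B[of t] by linarith
        then show ?thesis using True by (simp add: abs_mult mult_right_mono)
      qed simp
    qed
  qed (intro borel_measurable_times mK mv)
  then show ?thesis
    unfolding set_integrable_def
    by (rule Bochner_Integration.integrable_cong[THEN iffD1, rotated 2])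
       (auto simp: indicator_def)
qed

lemma set_integrable_const_Icc: "set_integrable lborel {x..y} (\<lambda>t. c::real)"
  for x y :: real
  by (rule borel_integrable_atLeastAtMost') auto

lemma set_integrable_bounded_Icc:
  fixes f :: "real \<Rightarrow> real"
  assumes "f \<in> borel_measurable lborel" "\<And>t. \<bar>f t\<bar> \<le> B"
  shows "set_integrable lborel {x..y} f"
proof (rule set_integrable_bound[where f = "\<lambda>_. B"])
  show "set_integrable lborel {x..y} (\<lambda>_. B)" by (rule set_integrable_const_Icc)
  show "set_borel_measurable lborel {x..y} f"
    using assms(1) unfolding set_borel_measurable_def by simp
  show "AE t in lborel. t \<in> {x..y} \<longrightarrow> norm (f t) \<le> norm B"
  proof (rule AE_I2, rule impI)
    fix t show "norm (f t) \<le> norm B" using assms(2)[of t] by simp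
  qed
qed

text \<open>Since v is merely the integral of an integrable function, the product rule is replaced
  by Fubini on the triangle s \<le> t: integrating k(t) v'(s) first in s gives k v, first in t gives
  (K(L) - K(s)) v'(s). The constant K(L) contributes K(L) v(L) = 0.\<close>

lemma set_integral_by_parts:
  fixes k K v v' :: "real \<Rightarrow> real"
  assumes k: "continuous_on {0..L} k"
    and K: "\<And>t. t \<in> {0..L} \<Longrightarrow> (K has_real_derivative k t) (at t within {0..L})"
    and v': "set_integrable lborel {0..L} v'"
    and v: "\<And>t. t \<in> {0..L} \<Longrightarrow> v t = (LBINT s:{0..t}. v' s)" and vL: "v L = 0" and L: "L \<ge> 0"
  shows "(LBINT t:{0..L}. k t * v t) = - (LBINT t:{0..L}. K t * v' t)"
proof -
  define k0 where "k0 t = indicator {0..L} t *\<^sub>R k t" for t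
  define v0 where "v0 t = indicator {0..L} t *\<^sub>R v' t" for t
  have ik: "integrable lborel k0"
    using borel_integrable_atLeastAtMost'[OF k] unfolding k0_def set_integrable_def .
  have iv: "integrable lborel v0"
    using v' unfolding v0_def set_integrable_def .
  have [measurable]: "k0 \<in> borel_measurable lborel" "v0 \<in> borel_measurable lborel"
    using ik iv by auto
  have "integrable (lborel \<Otimes>\<^sub>M lborel) (\<lambda>(t, s). k0 t * v0 s)"
  proof (rule lborel_pair.Fubini_integrable)
    show "integrable lborel (\<lambda>x. \<integral>y. norm (case (x, y) of (t, s) \<Rightarrow> k0 t * v0 s) \<partial>lborel)"
      using ik by (auto simp: abs_mult)
    show "AE x in lborel. integrable lborel (\<lambda>y. case (x, y) of (t, s) \<Rightarrow> k0 t * v0 s)"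
      using iv by auto
  qed measurable
  moreover have "{z \<in> space (lborel \<Otimes>\<^sub>M lborel). snd z \<le> (fst z :: real)} \<in> sets (lborel \<Otimes>\<^sub>M lborel)"
    by measurable
  ultimately have "integrable (lborel \<Otimes>\<^sub>M lborel) (\<lambda>z. indicator
      {z \<in> space (lborel \<Otimes>\<^sub>M lborel). snd z \<le> fst z} z *\<^sub>R (case z of (t, s) \<Rightarrow> k0 t * v0 s))"
    by (intro integrable_mult_indicator)
  then have int: "integrable (lborel \<Otimes>\<^sub>M lborel)
      (\<lambda>(t, s). indicator {..t} s * (k0 t * v0 s))"
    by (rule Bochner_Integration.integrable_cong[THEN iffD1, rotated 2])
       (auto simp: indicator_def space_pair_measure)
  have inner1: "(\<integral>s. indicator {..t} s * (k0 t * v0 s) \<partial>lborel) = indicator {0..L} t *\<^sub>R (k t * v t)" for t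
  proof (cases "t \<in> {0..L}")
    case True
    have "(\<integral>s. indicator {..t} s * (k0 t * v0 s) \<partial>lborel)
        = (\<integral>s. k0 t * (indicator {0..t} s *\<^sub>R v' s) \<partial>lborel)"
      by (rule Bochner_Integration.integral_cong) (use True in \<open>auto simp: v0_def indicator_def\<close>)
    also have "\<dots> = k0 t * v t"
      using v[OF True] by (simp add: set_lebesgue_integral_def)
    finally show ?thesis using True by (simp add: k0_def)
  qed (simp add: k0_def)
  have inner2: "(\<integral>t. indicator {..t} s * (k0 t * v0 s) \<partial>lborel)
      = indicator {0..L} s *\<^sub>R ((K L - K s) * v' s)" for s
  proof (cases "s \<in> {0..L}")
    case True
    have FTC: "(\<integral>t. indicator {s..L} t *\<^sub>R k t \<partial>lborel) = K L - K s"
    proof (rule integral_FTC_Icc)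
      show "s \<le> L" using True by simp
      show "(K has_vector_derivative k x) (at x within {s..L})" if "s \<le> x" "x \<le> L" for x
        using K[of x] that True
        by (intro has_vector_derivative_within_subset[where S = "{0..L}" and T = "{s..L}"])
           (auto simp: has_real_derivative_iff_has_vector_derivative)
      show "continuous_on {s..L} k"
        using k by (rule continuous_on_subset) (use True in auto)
    qed
    have "(\<integral>t. indicator {..t} s * (k0 t * v0 s) \<partial>lborel)
        = (\<integral>t. v0 s * (indicator {s..L} t *\<^sub>R k t) \<partial>lborel)"
      by (rule Bochner_Integration.integral_cong) (use True in \<open>auto simp: k0_def indicator_def\<close>)
    also have "\<dots> = v0 s * (K L - K s)"
      using FTC by simp
    finally show ?thesis using True by (simp add: v0_def)
  qed (simp add: v0_def)
  have cK: "continuous_on {0..L} K"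
    by (rule DERIV_continuous_on[OF K])
  have "(LBINT t:{0..L}. k t * v t) = (\<integral>t. (\<integral>s. indicator {..t} s * (k0 t * v0 s) \<partial>lborel) \<partial>lborel)"
    by (simp add: inner1 set_lebesgue_integral_def)
  also have "\<dots> = (\<integral>s. (\<integral>t. indicator {..t} s * (k0 t * v0 s) \<partial>lborel) \<partial>lborel)"
    by (rule lborel_pair.Fubini_integral[OF int, symmetric])
  also have "\<dots> = (LBINT s:{0..L}. K L * v' s - K s * v' s)"
    by (simp add: inner2 set_lebesgue_integral_def left_diff_distrib)
  also have "\<dots> = (LBINT s:{0..L}. K L * v' s) - (LBINT s:{0..L}. K s * v' s)"
    by (intro set_integral_diff set_integrable_continuous_mult[OF _ v'] cK continuous_intros)
  also have "(LBINT s:{0..L}. K L * v' s) = K L * v L"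
    using v[of L] L by simp
  finally show ?thesis using vL by simp
qed

lemma set_integral_const_Icc: "L \<ge> 0 \<Longrightarrow> (LBINT t:{0..L}. (c::real)) = c * L"
  by (simp add: set_lebesgue_integral_def)

text \<open>It suffices to test with the superlevel set of the mean value.\<close>

lemma AE_eq_mean:
  fixes F :: "real \<Rightarrow> real"
  assumes L: "L > 0" and int: "set_integrable lborel {0..L} F" and mF: "F \<in> borel_measurable lborel"
    and test: "\<And>B. B \<in> sets lborel \<Longrightarrow>
      (LBINT t:{0..L}. F t * (indicator B t - measure lborel (B \<inter> {0..L}) / L)) = 0"
  obtains m where "AE t in lborel. t \<in> {0..L} \<longrightarrow> F t = m"
proof -
  define m where "m = (LBINT t:{0..L}. F t) / L"
  define B where "B = {t. F t > m}"
  note [measurable] = mF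
  have B[measurable]: "B \<in> sets lborel" unfolding B_def by measurable
  define c where "c = measure lborel (B \<inter> {0..L}) / L"
  have iB: "set_integrable lborel {0..L} (\<lambda>t. F t * indicator B t)"
  proof -
    have "integrable lborel (\<lambda>t. indicator B t *\<^sub>R (indicator {0..L} t *\<^sub>R F t))"
      using int unfolding set_integrable_def by (rule integrable_mult_indicator[OF B])
    then show ?thesis unfolding set_integrable_def by (simp add: mult_ac)
  qed
  have i1: "set_integrable lborel {0..L} (\<lambda>t. indicator B t :: real)"
    by (rule set_integrable_bounded_Icc[where B = 1]) (auto simp: indicator_def)
  have iF: "(LBINT t:{0..L}. F t) = m * L" using L by (simp add: m_def)
  have meas: "(LBINT t:{0..L}. indicator B t) = c * L"
  proof -
    have "(LBINT t:{0..L}. indicator B t :: real) = (\<integral>t. indicator (B \<inter> {0..L}) t \<partial>lborel)"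
      unfolding set_lebesgue_integral_def by (auto intro!: Bochner_Integration.integral_cong simp: indicator_def)
    also have "\<dots> = measure lborel (B \<inter> {0..L})" by simp
    finally show ?thesis using L by (simp add: c_def)
  qed
  have "0 = (LBINT t:{0..L}. F t * (indicator B t - c))"
    using test[OF B] by (simp add: c_def)
  also have "\<dots> = (LBINT t:{0..L}. F t * indicator B t - c * F t)"
    by (simp add: algebra_simps)
  also have "\<dots> = (LBINT t:{0..L}. F t * indicator B t) - c * (m * L)"
    using iB int by (subst set_integral_diff) (auto simp: iF)
  finally have FB: "(LBINT t:{0..L}. F t * indicator B t) = c * (m * L)" by simp
  have "(LBINT t:{0..L}. F t * indicator B t - m * indicator B t) = 0"
    using iB i1 by (subst set_integral_diff) (auto simp: meas FB)
  then have z: "(\<integral>t. indicator {0..L} t * (F t * indicator B t - m * indicator B t) \<partial>lborel) = 0"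
    by (simp add: set_lebesgue_integral_def)
  have "set_integrable lborel {0..L} (\<lambda>t. F t * indicator B t - m * indicator B t)"
    using iB i1 by (intro set_integral_diff) auto
  then have iz: "integrable lborel (\<lambda>t. indicator {0..L} t * (F t * indicator B t - m * indicator B t))"
    by (simp add: set_integrable_def)
  have "AE t in lborel. 0 \<le> indicator {0..L} t * (F t * indicator B t - m * indicator B t)"
    by (rule AE_I2) (auto simp: B_def indicator_def)
  from integral_nonneg_eq_0_iff_AE[OF iz this] z
  have "AE t in lborel. indicator {0..L} t * (F t * indicator B t - m * indicator B t) = 0" by simp
  then have le: "AE t in lborel. t \<in> {0..L} \<longrightarrow> F t \<le> m"
    by eventually_elim (auto simp: B_def indicator_def split: if_splits)
  \<comment> \<open>The superlevel set is now known to be null within the interval, so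
    \<open>m - F\<close> is nonnegative almost everywhere; as m is the mean, its integral vanishes
    and it must be zero.\<close>
  have "(LBINT t:{0..L}. m - F t) = 0"
    using int set_integrable_const_Icc L by (subst set_integral_diff) (auto simp: iF set_integral_const_Icc)
  then have z2: "(\<integral>t. indicator {0..L} t * (m - F t) \<partial>lborel) = 0"
    by (simp add: set_lebesgue_integral_def)
  have "set_integrable lborel {0..L} (\<lambda>t. m - F t)"
    using int set_integrable_const_Icc by (intro set_integral_diff) auto
  then have iz2: "integrable lborel (\<lambda>t. indicator {0..L} t * (m - F t))"
    by (simp add: set_integrable_def)
  have "AE t in lborel. 0 \<le> indicator {0..L} t * (m - F t)"
    using le by eventually_elim (auto simp: indicator_def)
  from integral_nonneg_eq_0_iff_AE[OF iz2 this] z2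
  have "AE t in lborel. indicator {0..L} t * (m - F t) = 0" by simp
  then have "AE t in lborel. t \<in> {0..L} \<longrightarrow> F t = m"
    by eventually_elim (auto simp: indicator_def)
  then show ?thesis by (rule that)
qed

section \<open>Weak solutions and the first-order system\<close>

lemma weak_eig_eq_asym_flux:
  "weak_eig_eq p a b L lam u u' \<longleftrightarrow> (\<forall>v v'. W01p p L v v' \<longrightarrow>
     (LBINT t:{0..L}. asym_flux p a b (u' t) * v' t)
     = (LBINT t:{0..L}. lam * (\<bar>u t\<bar> powr (p - 2) * u t) * v t))"
  by (simp add: weak_eig_eq_def asym_flux_def)

lemma borel_measurable_asym_flux [measurable]: "asym_flux p a b \<in> borel_measurable borel"
  unfolding asym_flux_def by measurable

text \<open>The flux grows like |s|^(p-1), a power below p; on a bounded interval the L^p bound on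
  u' therefore makes it integrable. The summand 1 handles |s| \<le> 1.\<close>

lemma abs_asym_flux_le:
  assumes "p > 1"
  shows "\<bar>asym_flux p a b s\<bar> \<le> (a powr p + b powr p) * (1 + \<bar>s\<bar> powr p)"
proof -
  have le: "y powr (p - 1) \<le> 1 + \<bar>s\<bar> powr p" if "0 \<le> y" "y \<le> \<bar>s\<bar>" for y
  proof (cases "y \<le> 1")
    case True
    then have "y powr (p - 1) \<le> 1" using that assms by (intro powr_le1) auto
    then show ?thesis by (smt (verit) powr_ge_zero)
  next
    case False
    then have "y powr (p - 1) \<le> y powr p" by (intro powr_mono) auto
    also have "\<dots> \<le> \<bar>s\<bar> powr p" using that assms by (intro powr_mono2) auto
    finally show ?thesis by simp
  qed
  have "\<bar>asym_flux p a b s\<bar> \<le> a powr p * max s 0 powr (p - 1) + b powr p * max (- s) 0 powr (p - 1)"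
    unfolding asym_flux_def by (rule order_trans[OF abs_triangle_ineq4]) (simp add: abs_mult)
  also have "\<dots> \<le> a powr p * (1 + \<bar>s\<bar> powr p) + b powr p * (1 + \<bar>s\<bar> powr p)"
    by (intro add_mono mult_left_mono le) auto
  finally show ?thesis by (simp add: algebra_simps)
qed

lemma W01p_continuous_on:
  assumes "W01p p L u u'"
  shows "continuous_on {0..L} u"
proof -
  have int: "set_integrable lborel {0..L} u'" and u: "\<And>t. t \<in> {0..L} \<Longrightarrow> u t = (LBINT s:{0..t}. u' s)"
    using assms by (auto simp: W01p_def)
  have "u t = integral {0..t} u'" if "t \<in> {0..L}" for t
    unfolding u[OF that]
    by (rule set_borel_integral_eq_integral, rule set_integrable_subset[OF int]) (use that in auto)
  moreover have "continuous_on {0..L} (\<lambda>t. integral {0..t} u')"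
    by (rule indefinite_integral_continuous_1, rule set_borel_integral_eq_integral(1)[OF int])
  ultimately show ?thesis by (subst continuous_on_cong[OF refl]) auto
qed

text \<open>The argument of du Bois-Reymond. After integration by parts, flux plus K is orthogonal
  to every bounded function of mean zero that arises from an indicator, hence equals a constant m
  almost everywhere, and m - K is a continuously differentiable representative of the flux.\<close>

lemma weak_solution_imp_asym_sol:
  assumes p: "p > 1" and ab: "a > 0" "b > 0" and L: "L > 0"
    and W: "W01p p L u u'" and weak: "weak_eig_eq p a b L lam u u'"
  obtains w where "asym_sol p a b L lam u w"
proof -
  have mu[measurable]: "u' \<in> borel_measurable lborel"
    and intp: "set_integrable lborel {0..L} (\<lambda>t. \<bar>u' t\<bar> powr p)"
    and u: "\<And>t. t \<in> {0..L} \<Longrightarrow> u t = (LBINT s:{0..t}. u' s)"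
    using W by (auto simp: W01p_def)
  define k where "k t = lam * (\<bar>u t\<bar> powr (p - 2) * u t)" for t
  have ck: "continuous_on {0..L} k"
    unfolding k_def by (intro continuous_on_mult continuous_on_const continuous_on_odd_powr p W01p_continuous_on[OF W])
  define K where "K t = integral {0..t} k" for t
  have K: "(K has_real_derivative k t) (at t within {0..L})" if "t \<in> {0..L}" for t
    unfolding K_def by (rule integral_has_real_derivative[OF ck that])
  have cK: "continuous_on {0..L} K"
    by (rule DERIV_continuous_on[OF K])
  define f where "f t = asym_flux p a b (u' t)" for t
  have mf[measurable]: "f \<in> borel_measurable lborel" unfolding f_def by measurable
  have intf: "set_integrable lborel {0..L} f"
  proof (rule set_integrable_bound)
    show "set_integrable lborel {0..L} (\<lambda>t. (a powr p + b powr p) * (1 + \<bar>u' t\<bar> powr p))"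
      by (intro set_integrable_mult_right set_integral_add intp set_integrable_const_Icc)
    show "set_borel_measurable lborel {0..L} f"
      unfolding set_borel_measurable_def by measurable
    show "AE x in lborel. x \<in> {0..L} \<longrightarrow> norm (f x) \<le> norm ((a powr p + b powr p) * (1 + \<bar>u' x\<bar> powr p))"
    proof (rule AE_I2, rule impI)
      fix x
      have "norm (f x) \<le> (a powr p + b powr p) * (1 + \<bar>u' x\<bar> powr p)"
        unfolding f_def using abs_asym_flux_le[OF p] by simp
      then show "norm (f x) \<le> norm ((a powr p + b powr p) * (1 + \<bar>u' x\<bar> powr p))" by simp
    qed
  qed
  \<comment> \<open>Cut off by zero: outside \<open>{0..L}\<close> nothing is known about u, hence
    nothing about K, whereas \<open>AE_eq_mean\<close> asks for measurability on the whole
    line.\<close>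
  define F where "F t = indicator {0..L} t *\<^sub>R (f t + K t)" for t
  have intF': "set_integrable lborel {0..L} (\<lambda>t. f t + K t)"
    by (intro set_integral_add intf borel_integrable_atLeastAtMost' cK)
  have mF: "F \<in> borel_measurable lborel"
    using intF' unfolding F_def set_integrable_def by auto
  have intF: "set_integrable lborel {0..L} F"
    using intF' unfolding F_def set_integrable_def
    by (rule Bochner_Integration.integrable_cong[THEN iffD1, rotated 2]) (auto simp: indicator_def)
  have test: "(LBINT t:{0..L}. F t * (indicator B t - measure lborel (B \<inter> {0..L}) / L)) = 0"
    if B[measurable]: "B \<in> sets lborel" for B
  proof -
    define c where "c = measure lborel (B \<inter> {0..L}) / L"
    \<comment> \<open>An indicator minus its mean over the interval. Being bounded it lies in L^p
      for every p, and the mean zero gives the boundary value \<open>v L = 0\<close>.\<close>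
    define v' where "v' t = indicator B t - c" for t :: real
    define v where "v t = (LBINT s:{0..t}. v' s)" for t
    have mv[measurable]: "v' \<in> borel_measurable lborel" unfolding v'_def by measurable
    have bv: "\<bar>v' t\<bar> \<le> 1 + \<bar>c\<bar>" for t unfolding v'_def by (auto simp: indicator_def)
    have iv: "set_integrable lborel {x..y} v'" for x y
      using mv bv by (rule set_integrable_bounded_Icc)
    have ivp: "set_integrable lborel {x..y} (\<lambda>t. \<bar>v' t\<bar> powr p)" for x y
      by (rule set_integrable_bounded_Icc[where B = "(1 + \<bar>c\<bar>) powr p"])
         (use bv p in \<open>auto intro!: powr_mono2\<close>)
    have "v L = (LBINT t:{0..L}. indicator B t) - (LBINT t:{0..L}. c)"
      unfolding v_def v'_def
      by (intro set_integral_diff set_integrable_const_Icc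
          set_integrable_bounded_Icc[where B = 1]) (auto simp: indicator_def)
    also have "(LBINT t:{0..L}. indicator B t :: real) = (\<integral>t. indicator (B \<inter> {0..L}) t \<partial>lborel)"
      unfolding set_lebesgue_integral_def
      by (auto intro!: Bochner_Integration.integral_cong simp: indicator_def)
    also have "\<dots> = measure lborel (B \<inter> {0..L})" by simp
    also have "(LBINT t:{0..L}. c) = c * L" using L by (simp add: set_integral_const_Icc)
    finally have vL: "v L = 0" using L by (simp add: c_def)
    have Wv: "W01p p L v v'"
      unfolding W01p_def using mv iv ivp vL by (simp add: v_def)
    have "(LBINT t:{0..L}. f t * v' t) = (LBINT t:{0..L}. k t * v t)"
      using weak Wv unfolding weak_eig_eq_asym_flux f_def k_def by blast
    also have "\<dots> = - (LBINT t:{0..L}. K t * v' t)"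
      by (rule set_integral_by_parts[OF ck K iv]) (use L vL in \<open>auto simp: v_def\<close>)
    finally have "(LBINT t:{0..L}. f t * v' t) + (LBINT t:{0..L}. K t * v' t) = 0" by simp
    moreover have "(LBINT t:{0..L}. f t * v' t + K t * v' t)
        = (LBINT t:{0..L}. f t * v' t) + (LBINT t:{0..L}. K t * v' t)"
    proof (rule set_integral_add)
      show "set_integrable lborel {0..L} (\<lambda>t. K t * v' t)"
        by (rule set_integrable_continuous_mult[OF cK iv])
      show "set_integrable lborel {0..L} (\<lambda>t. f t * v' t)"
      proof (rule set_integrable_bound)
        show "set_integrable lborel {0..L} (\<lambda>t. (1 + \<bar>c\<bar>) * f t)"
          using intf by simp
        show "set_borel_measurable lborel {0..L} (\<lambda>t. f t * v' t)"
          unfolding set_borel_measurable_def by measurable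
        show "AE x in lborel. x \<in> {0..L} \<longrightarrow> norm (f x * v' x) \<le> norm ((1 + \<bar>c\<bar>) * f x)"
          using bv by (intro AE_I2) (auto simp: abs_mult mult.commute[of "\<bar>f _\<bar>"] intro!: mult_right_mono)
      qed
    qed
    ultimately have "(LBINT t:{0..L}. (f t + K t) * v' t) = 0"
      by (simp add: distrib_right)
    moreover have "(LBINT t:{0..L}. F t * v' t) = (LBINT t:{0..L}. (f t + K t) * v' t)"
      by (rule set_lebesgue_integral_cong) (auto simp: F_def)
    ultimately show ?thesis by (simp add: v'_def c_def)
  qed
  obtain m where m: "AE t in lborel. t \<in> {0..L} \<longrightarrow> F t = m"
    using AE_eq_mean[OF L intF mF test] by blast
  define w where "w t = m - K t" for t
  have cg: "continuous_on {0..L} (\<lambda>t. flux_inv p a b (w t))"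
    unfolding w_def by (intro continuous_on_flux_inv p ab continuous_intros cK)
  have ae: "AE t in lborel. t \<in> {0..L} \<longrightarrow> u' t = flux_inv p a b (w t)"
    using m
  proof eventually_elim
    case (elim t)
    show ?case
    proof
      assume "t \<in> {0..L}"
      then have "asym_flux p a b (u' t) = w t" using elim by (simp add: F_def f_def w_def)
      then show "u' t = flux_inv p a b (w t)"
        using flux_inv_asym_flux[OF p ab, of "u' t"] by simp
    qed
  qed
  \<comment> \<open>The identity for u' holds only almost everywhere, but u is the integral of u'.
    It is thus the integral of a continuous function and differentiable at every point.\<close>
  have u_eq: "u t = integral {0..t} (\<lambda>s. flux_inv p a b (w s))" if t: "t \<in> {0..L}" for t
  proof -
    have ig: "set_integrable lborel {0..t} (\<lambda>s. flux_inv p a b (w s))"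
      by (rule borel_integrable_atLeastAtMost', rule continuous_on_subset[OF cg]) (use t in auto)
    have "u t = (LBINT s:{0..t}. u' s)" by (rule u[OF t])
    also have "\<dots> = (LBINT s:{0..t}. flux_inv p a b (w s))"
      unfolding set_lebesgue_integral_def
    proof (rule integral_cong_AE)
      show "(\<lambda>s. indicator {0..t} s *\<^sub>R flux_inv p a b (w s)) \<in> borel_measurable lborel"
        using ig unfolding set_integrable_def by (rule borel_measurable_integrable)
      show "AE s in lborel. indicator {0..t} s *\<^sub>R u' s = indicator {0..t} s *\<^sub>R flux_inv p a b (w s)"
        using ae by eventually_elim (use t in \<open>auto simp: indicator_def\<close>)
    qed measurable
    also have "\<dots> = integral {0..t} (\<lambda>s. flux_inv p a b (w s))"
      by (rule set_borel_integral_eq_integral(2)[OF ig])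
    finally show ?thesis .
  qed
  have "asym_sol p a b L lam u w"
    unfolding asym_sol_def
  proof (intro ballI conjI)
    fix t assume t: "t \<in> {0..L}"
    show "(u has_real_derivative flux_inv p a b (w t)) (at t within {0..L})"
      using integral_has_real_derivative[OF cg t]
      by (rule has_field_derivative_transform_within[OF _ zero_less_one t]) (simp add: u_eq)
    show "(w has_real_derivative - lam * (\<bar>u t\<bar> powr (p - 2) * u t)) (at t within {0..L})"
      using K[OF t] unfolding w_def k_def by (auto intro!: derivative_eq_intros)
  qed
  then show ?thesis by (rule that)
qed

lemma asym_sol_imp_weak_solution:
  assumes p: "p > 1" and ab: "a > 0" "b > 0" and L: "L > 0"
    and sol: "asym_sol p a b L lam u w" and bc: "u 0 = 0" "u L = 0"
  obtains u' where "W01p p L u u'" "weak_eig_eq p a b L lam u u'"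
proof -
  note cu = asym_sol_continuous(1)[OF sol] and cw = asym_sol_continuous(2)[OF sol]
  define g where "g t = flux_inv p a b (w t)" for t
  have cg: "continuous_on {0..L} g"
    unfolding g_def by (intro continuous_on_flux_inv p ab cw)
  \<comment> \<open>The cut-off makes u' measurable on the whole line, as \<open>W01p\<close>
    demands; w is arbitrary outside the interval.\<close>
  define u' where "u' t = indicator {0..L} t *\<^sub>R g t" for t
  have cu': "continuous_on {0..L} u'"
    using cg by (rule continuous_on_eq) (simp add: u'_def)
  have du: "(u has_real_derivative g t) (at t within {0..L})"
   and dw: "(w has_real_derivative - lam * (\<bar>u t\<bar> powr (p - 2) * u t)) (at t within {0..L})"
   if "t \<in> {0..L}" for t
    using sol that by (auto simp: asym_sol_def g_def)
  have W: "W01p p L u u'"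
    unfolding W01p_def
  proof (intro conjI ballI)
    show "u' \<in> borel_measurable lborel"
      unfolding u'_def using borel_measurable_continuous_on_indicator[OF _ cg] by simp
    show "set_integrable lborel {0..L} u'" by (rule borel_integrable_atLeastAtMost'[OF cu'])
    show "set_integrable lborel {0..L} (\<lambda>t. \<bar>u' t\<bar> powr p)"
      by (rule borel_integrable_atLeastAtMost', intro continuous_on_powr' continuous_intros cu')
         (use p in auto)
    show "u L = 0" by (rule bc)
    fix t assume t: "t \<in> {0..L}"
    have "(\<integral>s. indicator {0..t} s *\<^sub>R u' s \<partial>lborel) = u t - u 0"
    proof (rule integral_FTC_Icc)
      show "(u has_vector_derivative u' x) (at x within {0..t})" if "0 \<le> x" "x \<le> t" for x
        using du[of x] that t
        by (intro has_vector_derivative_within_subset[where S = "{0..L}" and T = "{0..t}"])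
           (auto simp: has_real_derivative_iff_has_vector_derivative u'_def)
      show "continuous_on {0..t} u'"
        using cu' by (rule continuous_on_subset) (use t in auto)
    qed (use t in auto)
    then show "u t = (LBINT s:{0..t}. u' s)" by (simp add: bc set_lebesgue_integral_def)
  qed
  have "weak_eig_eq p a b L lam u u'"
    unfolding weak_eig_eq_asym_flux
  proof (intro allI impI)
    fix v v' assume Wv: "W01p p L v v'"
    define k where "k t = - lam * (\<bar>u t\<bar> powr (p - 2) * u t)" for t
    have ck: "continuous_on {0..L} k"
      unfolding k_def by (intro continuous_on_mult continuous_on_const continuous_on_odd_powr p cu)
    have "(LBINT t:{0..L}. k t * v t) = - (LBINT t:{0..L}. w t * v' t)"
      by (rule set_integral_by_parts[OF ck])
         (use dw Wv L in \<open>auto simp: k_def W01p_def\<close>)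
    moreover have "(LBINT t:{0..L}. k t * v t) = (LBINT t:{0..L}. - (lam * (\<bar>u t\<bar> powr (p - 2) * u t) * v t))"
      by (simp add: k_def)
    ultimately have "(LBINT t:{0..L}. w t * v' t) = (LBINT t:{0..L}. lam * (\<bar>u t\<bar> powr (p - 2) * u t) * v t)"
      by (simp add: set_lebesgue_integral_def)
    moreover have "(LBINT t:{0..L}. asym_flux p a b (u' t) * v' t) = (LBINT t:{0..L}. w t * v' t)"
      by (rule set_lebesgue_integral_cong) (auto simp: u'_def g_def asym_flux_flux_inv[OF p ab])
    ultimately show "(LBINT t:{0..L}. asym_flux p a b (u' t) * v' t)
        = (LBINT t:{0..L}. lam * (\<bar>u t\<bar> powr (p - 2) * u t) * v t)" by simp
  qed
  with W show ?thesis by (rule that)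
qed

section \<open>Nonzero initial flux and positivity of the eigenvalue\<close>

lemma asym_sol_unique_zero:
  assumes p: "p > 1" and ab: "a > 0" "b > 0" and sol: "asym_sol p a b L lam u w"
    and lam: "lam > 0" and init: "u 0 = 0" "w 0 = 0" and t: "t \<in> {0..L}"
  shows "u t = 0"
proof -
  have "asym_energy p a b lam (u t) (w t) = 0"
    using asym_energy_const[OF p ab sol t] init p by (simp add: asym_energy_def)
  moreover have "lam * \<bar>u t\<bar> powr p \<le> asym_energy p a b lam (u t) (w t)"
    unfolding asym_energy_def using p by simp
  ultimately have "\<bar>u t\<bar> powr p \<le> 0" using lam by (simp add: mult_le_0_iff)
  then show ?thesis by simp
qed

text \<open>A pointwise form of testing the equation with u. If lam \<le> 0, then (u w)' = u' w -
  lam |u|^p is nonnegative, so u w is monotone with zero values at both ends and vanishes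
  identically. A point with w \<noteq> 0 would make (u w)' positive; hence w = 0 inside, u is
  constant, and u = 0.\<close>

lemma asym_sol_eigenvalue_pos:
  assumes p: "p > 1" and ab: "a > 0" "b > 0" and L: "L > 0" and sol: "asym_sol p a b L lam u w"
    and bc: "u 0 = 0" "u L = 0" and nz: "t1 \<in> {0..L}" "u t1 \<noteq> 0"
  shows "lam > 0"
proof (rule ccontr)
  assume lam: "\<not> lam > 0"
  note cu = asym_sol_continuous(1)[OF sol] and cw = asym_sol_continuous(2)[OF sol]
  have D: "((\<lambda>t. u t * w t) has_real_derivative
      flux_inv p a b (w t) * w t - lam * (\<bar>u t\<bar> powr (p - 2) * (u t)\<^sup>2)) (at t)"
    and Du: "(u has_real_derivative flux_inv p a b (w t)) (at t)"
    if "t \<in> {0<..<L}" for t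
  proof -
    have at: "at t within {0..L} = at t" using that by (intro at_within_interior) auto
    have *: "(u has_real_derivative flux_inv p a b (w t)) (at t)"
       "(w has_real_derivative - lam * (\<bar>u t\<bar> powr (p - 2) * u t)) (at t)"
      using sol that unfolding asym_sol_def at[symmetric] by auto
    show "(u has_real_derivative flux_inv p a b (w t)) (at t)" by fact
    show "((\<lambda>t. u t * w t) has_real_derivative
      flux_inv p a b (w t) * w t - lam * (\<bar>u t\<bar> powr (p - 2) * (u t)\<^sup>2)) (at t)"
      by (rule derivative_eq_intros * refl)+ (simp add: algebra_simps power2_eq_square)
  qed
  have gw: "flux_inv p a b y * y \<ge> 0" for y
    using flux_inv_times_pos[OF ab, of y p] by (cases "y = 0") auto
  have lu: "- lam * (\<bar>x\<bar> powr (p - 2) * x\<^sup>2) \<ge> 0" for x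
    using lam by (intro mult_nonneg_nonneg) auto
  have mono: "u s * w s \<le> u t * w t" if "0 \<le> s" "s \<le> t" "t \<le> L" for s t
  proof (rule DERIV_nonneg_imp_increasing_open[OF that(2)])
    show "\<exists>y. ((\<lambda>t. u t * w t) has_real_derivative y) (at x) \<and> 0 \<le> y" if "s < x" "x < t" for x
    proof (intro exI conjI)
      show "((\<lambda>t. u t * w t) has_real_derivative
          flux_inv p a b (w x) * w x - lam * (\<bar>u x\<bar> powr (p - 2) * (u x)\<^sup>2)) (at x)"
        by (rule D) (use that \<open>0 \<le> s\<close> \<open>t \<le> L\<close> in auto)
      show "0 \<le> flux_inv p a b (w x) * w x - lam * (\<bar>u x\<bar> powr (p - 2) * (u x)\<^sup>2)"
        using gw[of "w x"] lu[of "u x"] by simp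
    qed
    show "continuous_on {s..t} (\<lambda>t. u t * w t)"
      by (rule continuous_on_subset[OF continuous_on_mult[OF cu cw]]) (use that in auto)
  qed
  have uw: "u t * w t = 0" if "t \<in> {0..L}" for t
    using mono[of 0 t] mono[of t L] that bc by auto
  have w0: "w t = 0" if t: "t \<in> {0<..<L}" for t
  proof (rule ccontr)
    assume "w t \<noteq> 0"
    then have "flux_inv p a b (w t) * w t > 0" by (rule flux_inv_times_pos[OF ab])
    moreover have "((\<lambda>t. u t * w t) has_real_derivative 0) (at t)"
    proof (rule has_field_derivative_transform_within_open[where f = "\<lambda>_. 0" and S = "{0<..<L}"])
      show "0 = u x * w x" if "x \<in> {0<..<L}" for x using uw[of x] that by simp
    qed (use t in auto)
    then have "flux_inv p a b (w t) * w t - lam * (\<bar>u t\<bar> powr (p - 2) * (u t)\<^sup>2) = 0"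
      using D[OF t] DERIV_unique by blast
    ultimately show False using lu[of "u t"] by simp
  qed
  have "u t1 = u 0"
  proof (cases "t1 = 0")
    case False
    show ?thesis
    proof (rule DERIV_isconst_end[where f = u])
      show "0 < t1" using False nz by simp
      show "continuous_on {0..t1} u" by (rule continuous_on_subset[OF cu]) (use nz in auto)
      show "(u has_real_derivative 0) (at x)" if "0 < x" "x < t1" for x
        using Du[of x] w0[of x] that nz by simp
    qed
  qed simp
  with nz bc show False by simp
qed

section \<open>The generalised sine\<close>

definition arcsin_density :: "real \<Rightarrow> real \<Rightarrow> real" where
  "arcsin_density p s = (1 - \<bar>s\<bar> powr p) powr (- 1 / p)"

text \<open>Starting the integral at -1 gives one formula for all x in [-1, 1]; subtracting half of
  the total makes the function odd with value 0 at 0.\<close>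

definition arcsin_p :: "real \<Rightarrow> real \<Rightarrow> real" where
  "arcsin_p p x = integral {-1..x} (arcsin_density p) - integral {-1..1} (arcsin_density p) / 2"

text \<open>The principal branch only, on [-pi_p/2, pi_p/2]. All oscillation comes from the
  triangular \<open>wave_phase\<close>, whose values stay in this range.\<close>

definition sin_p :: "real \<Rightarrow> real \<Rightarrow> real" where
  "sin_p p = inv_into {-1..1} (arcsin_p p)"

lemma abs_powr_less_1: "p > 0 \<Longrightarrow> \<bar>s::real\<bar> < 1 \<Longrightarrow> \<bar>s\<bar> powr p < 1"
  using powr_less_mono2[of p "\<bar>s\<bar>" 1] by simp

lemma abs_powr_le_1: "p > 0 \<Longrightarrow> \<bar>s::real\<bar> \<le> 1 \<Longrightarrow> \<bar>s\<bar> powr p \<le> 1"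
  using powr_mono2[of p "\<bar>s\<bar>" 1] by simp

lemma arcsin_density_pos: "p > 1 \<Longrightarrow> \<bar>s\<bar> < 1 \<Longrightarrow> arcsin_density p s > 0"
  using abs_powr_less_1[of p s] by (simp add: arcsin_density_def)

lemma isCont_arcsin_density:
  assumes "p > 1" "\<bar>s\<bar> < 1"
  shows "isCont (arcsin_density p) s"
  unfolding arcsin_density_def
  using abs_powr_less_1[of p s] assms
  by (intro continuous_at_within_powr continuous_diff continuous_const
      DERIV_isCont[OF has_real_derivative_abs_powr]) auto

text \<open>The singularity at 1 is dominated by a Beta integrand: t^p \<le> t on (0, 1), so the
  density is at most (1-t)^(-1/p), and 1/p < 1.\<close>

lemma set_integrable_arcsin_density:
  assumes p: "p > 1"
  shows "set_integrable lborel {0<..<1} (arcsin_density p)"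
proof (rule set_integrable_bound)
  have "set_integrable lborel {0..1} (\<lambda>t::real. t powr (1 - 1) * (1 - t) powr (1 - 1 / p - 1))"
    by (rule integrable_Beta) (use p in auto)
  then show "set_integrable lborel {0<..<1} (\<lambda>t::real. t powr (1 - 1) * (1 - t) powr (1 - 1 / p - 1))"
    by (rule set_integrable_subset) auto
  show "set_borel_measurable lborel {0<..<1} (arcsin_density p)"
    unfolding set_borel_measurable_def arcsin_density_def by measurable
  show "AE t in lborel. t \<in> {0<..<1} \<longrightarrow> norm (arcsin_density p t)
      \<le> norm (t powr (1 - 1) * (1 - t) powr (1 - 1 / p - 1))"
  proof (intro AE_I2 impI)
    fix t :: real assume t: "t \<in> {0<..<1}"
    have "t powr p \<le> t powr 1" using t p by (intro powr_mono') auto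
    then have "(1 - t powr p) powr (- 1 / p) \<le> (1 - t) powr (- 1 / p)"
      using t p by (intro powr_mono2') auto
    then show "norm (arcsin_density p t) \<le> norm (t powr (1 - 1) * (1 - t) powr (1 - 1 / p - 1))"
      using t by (simp add: arcsin_density_def)
  qed
qed

lemma integrable_arcsin_density:
  assumes p: "p > 1"
  shows "arcsin_density p integrable_on {-1..1}"
    and "integral {0..1} (arcsin_density p) = pi_p p / 2"
proof -
  have i1: "arcsin_density p integrable_on {0..1}"
    using set_borel_integral_eq_integral(1)[OF set_integrable_arcsin_density[OF p]]
    by (simp add: integrable_on_open_interval_real)
  moreover have "(\<lambda>x. arcsin_density p (- x)) = arcsin_density p"
    by (simp add: arcsin_density_def[abs_def])
  ultimately have i0: "arcsin_density p integrable_on {-1..0}"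
    using Henstock_Kurzweil_Integration.integrable_reflect_real[where f = "arcsin_density p" and a = 0 and b = 1] by simp
  show "arcsin_density p integrable_on {-1..1}"
    by (rule Henstock_Kurzweil_Integration.integrable_combine[OF _ _ i0 i1]) auto
  have "pi_p p = 2 * (LBINT t:{0<..<1}. arcsin_density p t)"
    unfolding pi_p_def
    by (intro arg_cong[where f = "(*) 2"] set_lebesgue_integral_cong) (auto simp: arcsin_density_def)
  also have "(LBINT t:{0<..<1}. arcsin_density p t) = integral {0..1} (arcsin_density p)"
    using set_borel_integral_eq_integral(2)[OF set_integrable_arcsin_density[OF p]]
    by (simp add: integral_open_interval_real)
  finally show "integral {0..1} (arcsin_density p) = pi_p p / 2" by simp
qed

section \<open>Arcsine and sine on the principal branch\<close>

context
  fixes p :: real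
  assumes p: "p > 1"
begin

lemma continuous_on_arcsin_p: "continuous_on {-1..1} (arcsin_p p)"
  unfolding arcsin_p_def
  by (intro continuous_intros indefinite_integral_continuous_1 integrable_arcsin_density p)

lemma has_real_derivative_arcsin_p:
  assumes "\<bar>x\<bar> < 1"
  shows "(arcsin_p p has_real_derivative arcsin_density p x) (at x)"
proof -
  have "((\<lambda>x. integral {-1..x} (arcsin_density p)) has_vector_derivative arcsin_density p x)
      (at x within {-1..1} - {})"
  proof (rule integral_has_vector_derivative_continuous_at)
    show "arcsin_density p integrable_on {-1..1}" by (rule integrable_arcsin_density(1)[OF p])
    show "continuous (at x within {-1..1} - {}) (arcsin_density p)"
      by (rule continuous_at_imp_continuous_at_within, rule isCont_arcsin_density[OF p assms])
  qed (use assms in auto)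
  moreover have "at x within {-1..1} = at x"
    using assms by (intro at_within_interior) auto
  ultimately have "((\<lambda>x. integral {-1..x} (arcsin_density p)) has_real_derivative arcsin_density p x) (at x)"
    by (simp add: has_real_derivative_iff_has_vector_derivative)
  then show ?thesis
    unfolding arcsin_p_def by (auto intro!: derivative_eq_intros)
qed

lemma arcsin_p_minus:
  assumes "\<bar>x\<bar> \<le> 1"
  shows "arcsin_p p (- x) = - arcsin_p p x"
proof -
  define g where "g x = arcsin_p p x + arcsin_p p (- x)" for x
  have "continuous_on {-1..1} (\<lambda>x. arcsin_p p (- x))"
    by (rule continuous_on_compose2[OF continuous_on_arcsin_p]) (auto intro!: continuous_intros)
  then have "continuous_on {-1..1} g"
    unfolding g_def by (intro continuous_intros continuous_on_arcsin_p)
  moreover have "(g has_real_derivative 0) (at x)" if "- 1 < x" "x < 1" for x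
  proof -
    have "(g has_real_derivative arcsin_density p x + arcsin_density p (- x) * (- 1)) (at x)"
      unfolding g_def
      by (intro DERIV_add DERIV_chain2[where f = "arcsin_p p" and g = uminus] has_real_derivative_arcsin_p)
         (use that in \<open>auto intro!: derivative_eq_intros\<close>)
    then show ?thesis by (simp add: arcsin_density_def)
  qed
  ultimately have "g x = g (-1)"
    using DERIV_isconst2[of "-1" 1 g x] assms by auto
  moreover have "g (-1) = 0" by (simp add: g_def arcsin_p_def)
  ultimately show ?thesis by (simp add: g_def)
qed

lemma arcsin_p_strict_mono:
  assumes "-1 \<le> x" "x < y" "y \<le> 1"
  shows "arcsin_p p x < arcsin_p p y"
proof (rule DERIV_pos_imp_increasing_open[OF assms(2)])
  show "\<exists>d. (arcsin_p p has_real_derivative d) (at z) \<and> 0 < d" if "x < z" "z < y" for z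
  proof (intro exI conjI)
    have "\<bar>z\<bar> < 1" using that assms by auto
    then show "(arcsin_p p has_real_derivative arcsin_density p z) (at z)" "0 < arcsin_density p z"
      by (rule has_real_derivative_arcsin_p, rule arcsin_density_pos[OF p])
  qed
  show "continuous_on {x..y} (arcsin_p p)"
    by (rule continuous_on_subset[OF continuous_on_arcsin_p]) (use assms in auto)
qed

lemma inj_on_arcsin_p: "inj_on (arcsin_p p) {-1..1}"
proof (rule inj_onI)
  fix x y assume "x \<in> {-1..1}" "y \<in> {-1..1}" "arcsin_p p x = arcsin_p p y"
  then show "x = y"
    using arcsin_p_strict_mono[of x y] arcsin_p_strict_mono[of y x]
    by (cases x y rule: linorder_cases) auto
qed

lemma arcsin_p_1: "arcsin_p p 1 = pi_p p / 2"
proof -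
  have "integral {-1..0} (arcsin_density p) + integral {0..1} (arcsin_density p)
      = integral {-1..1} (arcsin_density p)"
    by (rule Henstock_Kurzweil_Integration.integral_combine) (auto intro!: integrable_arcsin_density p)
  moreover have "arcsin_p p 0 = 0"
    using arcsin_p_minus[of 0] by simp
  ultimately show ?thesis
    using integrable_arcsin_density(2)[OF p] by (simp add: arcsin_p_def)
qed

lemma arcsin_p_0: "arcsin_p p 0 = 0"
  using arcsin_p_minus[of 0] by simp

lemma pi_p_pos: "pi_p p > 0"
  using arcsin_p_strict_mono[of 0 1] arcsin_p_0 arcsin_p_1 by simp

lemma arcsin_p_image: "arcsin_p p ` {-1..1} = {- pi_p p / 2..pi_p p / 2}"
proof (intro equalityI subsetI)
  fix y assume "y \<in> arcsin_p p ` {-1..1}"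
  then obtain x where x: "-1 \<le> x" "x \<le> 1" "y = arcsin_p p x" by auto
  have "arcsin_p p (-1) \<le> arcsin_p p x"
    using arcsin_p_strict_mono[of "-1" x] x by (cases "x = -1") auto
  moreover have "arcsin_p p x \<le> arcsin_p p 1"
    using arcsin_p_strict_mono[of x 1] x by (cases "x = 1") auto
  ultimately show "y \<in> {- pi_p p / 2..pi_p p / 2}"
    using x arcsin_p_minus[of 1] arcsin_p_1 by simp
next
  fix y assume y: "y \<in> {- pi_p p / 2..pi_p p / 2}"
  have "\<exists>x\<ge>-1. x \<le> 1 \<and> arcsin_p p x = y"
    by (rule IVT'[OF _ _ _ continuous_on_arcsin_p]) (use y arcsin_p_minus[of 1] arcsin_p_1 in auto)
  then show "y \<in> arcsin_p p ` {-1..1}" by auto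
qed

lemma sin_p_arcsin_p: "\<bar>x\<bar> \<le> 1 \<Longrightarrow> sin_p p (arcsin_p p x) = x"
  unfolding sin_p_def by (intro inv_into_f_f inj_on_arcsin_p) auto

lemma arcsin_p_sin_p: "\<bar>y\<bar> \<le> pi_p p / 2 \<Longrightarrow> arcsin_p p (sin_p p y) = y"
  unfolding sin_p_def by (intro f_inv_into_f) (auto simp: arcsin_p_image)

lemma abs_sin_p_le_1: "\<bar>y\<bar> \<le> pi_p p / 2 \<Longrightarrow> \<bar>sin_p p y\<bar> \<le> 1"
  using inv_into_into[of y "arcsin_p p" "{-1..1}"]
  unfolding sin_p_def arcsin_p_image atLeastAtMost_iff abs_le_iff by linarith

lemma continuous_on_sin_p: "continuous_on {- pi_p p / 2..pi_p p / 2} (sin_p p)"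
  unfolding arcsin_p_image[symmetric]
  by (rule continuous_on_inv[OF continuous_on_arcsin_p]) (auto simp: sin_p_arcsin_p)

lemma sin_p_minus: "\<bar>y\<bar> \<le> pi_p p / 2 \<Longrightarrow> sin_p p (- y) = - sin_p p y"
  using arcsin_p_minus[of "sin_p p y"] sin_p_arcsin_p[of "- sin_p p y"] abs_sin_p_le_1[of y]
    arcsin_p_sin_p[of y] by simp

lemma sin_p_0: "sin_p p 0 = 0"
  using sin_p_arcsin_p[of 0] arcsin_p_0 by simp

lemma sin_p_pi_half: "sin_p p (pi_p p / 2) = 1"
  using sin_p_arcsin_p[of 1] arcsin_p_1 by simp

lemma sin_p_pos: "0 < y \<Longrightarrow> y \<le> pi_p p / 2 \<Longrightarrow> 0 < sin_p p y"
proof -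
  assume y: "0 < y" "y \<le> pi_p p / 2"
  then have x: "\<bar>sin_p p y\<bar> \<le> 1" "arcsin_p p (sin_p p y) = y"
    using abs_sin_p_le_1[of y] arcsin_p_sin_p[of y] by auto
  show ?thesis
  proof (rule ccontr)
    assume "\<not> 0 < sin_p p y"
    then have "arcsin_p p (sin_p p y) \<le> 0"
      using arcsin_p_strict_mono[of "sin_p p y" 0] arcsin_p_0 x by (cases "sin_p p y = 0") auto
    with x y show False by simp
  qed
qed

lemma abs_sin_p_less_1: "\<bar>y\<bar> < pi_p p / 2 \<Longrightarrow> \<bar>sin_p p y\<bar> < 1"
proof -
  assume y: "\<bar>y\<bar> < pi_p p / 2"
  have "\<bar>sin_p p y\<bar> \<noteq> 1"
  proof
    assume "\<bar>sin_p p y\<bar> = 1"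
    then have "arcsin_p p (sin_p p y) \<in> {arcsin_p p 1, arcsin_p p (-1)}" by (auto simp: abs_if split: if_splits)
    then show False using arcsin_p_minus[of 1] arcsin_p_1 arcsin_p_sin_p[of y] y by auto
  qed
  then show ?thesis using abs_sin_p_le_1[of y] y by simp
qed

lemma has_real_derivative_sin_p:
  assumes y: "\<bar>y\<bar> < pi_p p / 2"
  shows "(sin_p p has_real_derivative (1 - \<bar>sin_p p y\<bar> powr p) powr (1 / p)) (at y)"
proof -
  note s = abs_sin_p_less_1[OF y]
  have "isCont (sin_p p) y"
    by (rule continuous_on_interior[OF continuous_on_sin_p]) (use y in \<open>auto simp: abs_less_iff\<close>)
  then have "(sin_p p has_real_derivative inverse (arcsin_density p (sin_p p y))) (at y)"
    using has_real_derivative_arcsin_p[OF s] arcsin_density_pos[OF p s] y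
    by (intro DERIV_inverse_function[where f = "arcsin_p p" and a = "- pi_p p / 2" and b = "pi_p p / 2"])
       (auto intro!: arcsin_p_sin_p)
  then show ?thesis
    by (simp add: arcsin_density_def powr_minus)
qed

text \<open>The function differentiated here is the derivative of \<open>sin_p\<close> raised to the
  power p - 1, that is, its classical flux. So \<open>sin_p\<close> solves -(|u'|^(p-2) u')' = (p-1)
  |u|^(p-2) u.\<close>

lemma has_real_derivative_cos_p:
  assumes y: "\<bar>y\<bar> < pi_p p / 2"
  shows "((\<lambda>y. (1 - \<bar>sin_p p y\<bar> powr p) powr ((p - 1) / p)) has_real_derivative
      - (p - 1) * (\<bar>sin_p p y\<bar> powr (p - 2) * sin_p p y)) (at y)"
proof -
  define s where "s = sin_p p y"
  define h where "h = \<bar>s\<bar> powr (p - 2) * s"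
  define c where "c = 1 - \<bar>s\<bar> powr p"
  have c: "c > 0" using abs_powr_less_1[of p s] abs_sin_p_less_1[OF y] p by (simp add: c_def s_def)
  have 1: "((\<lambda>y. \<bar>sin_p p y\<bar> powr p) has_real_derivative p * h * c powr (1 / p)) (at y)"
    unfolding h_def c_def s_def
    by (rule DERIV_chain2[OF has_real_derivative_abs_powr[OF p] has_real_derivative_sin_p[OF y]])
  have "((\<lambda>z. z powr ((p - 1) / p)) has_real_derivative ((p - 1) / p) * c powr ((p - 1) / p - 1)) (at c)"
    using c by (rule has_real_derivative_powr)
  from DERIV_chain2[where f = "\<lambda>z. z powr ((p - 1) / p)" and g = "\<lambda>y. 1 - \<bar>sin_p p y\<bar> powr p",
      OF _ DERIV_diff[OF DERIV_const 1], folded s_def, folded c_def, OF this]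
  have "((\<lambda>y. (1 - \<bar>sin_p p y\<bar> powr p) powr ((p - 1) / p)) has_real_derivative
      (p - 1) / p * c powr ((p - 1) / p - 1) * (0 - p * h * c powr (1 / p))) (at y)" .
  moreover have "(p - 1) / p * c powr ((p - 1) / p - 1) * (0 - p * h * c powr (1 / p))
     = - (p - 1) * h * (c powr ((p - 1) / p - 1) * c powr (1 / p))"
    using p by (simp add: field_simps)
  moreover have "c powr ((p - 1) / p - 1) * c powr (1 / p) = 1"
  proof -
    have "(p - 1) / p - 1 + 1 / p = 0" using p by (simp add: field_simps)
    then show ?thesis using c powr_add[of c "(p - 1) / p - 1" "1 / p"] by simp
  qed
  ultimately show ?thesis unfolding h_def s_def by simp
qed

end

section \<open>Uniqueness of the initial value problem\<close>

lemma asym_energy_minus: "asym_energy p b a lam (- u) (- w) = asym_energy p a b lam u w"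
  by (simp add: asym_energy_def add.commute)

lemma asym_energy_bound:
  assumes "p > 1" "lam > 0"
  shows "lam * \<bar>u\<bar> powr p \<le> asym_energy p a b lam u w"
  using assms by (simp add: asym_energy_def)

lemma asym_energy_pos_flux:
  assumes "p > 1" "a > 0" "w > 0"
  shows "asym_energy p a b lam u w = (p - 1) * ((w / a) powr (1 / (p - 1))) powr p + lam * \<bar>u\<bar> powr p"
  using assms by (simp add: asym_energy_def powr_powr)

section \<open>Comparison of two solutions on one energy level\<close>

context
  fixes p lam M E :: real
  assumes p: "p > 1" and lam: "lam > 0" and E: "E > 0" and M_def: "M = (E / lam) powr (1 / p)"
begin

lemma amplitude_pos: "M > 0"
  using E lam by (simp add: M_def)

text \<open>M is the value of |u| at vanishing flux, hence the largest one that the energy E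
  admits.\<close>

lemma energy_eq_amplitude: "E = lam * M powr p"
  using E lam p by (simp add: M_def powr_powr)

lemma abs_quotient_le_1:
  assumes "asym_energy p a b lam u w = E"
  shows "\<bar>u / M\<bar> \<le> 1"
proof -
  have "lam * \<bar>u\<bar> powr p \<le> lam * M powr p"
    using asym_energy_bound[OF p lam, of u a b w] assms energy_eq_amplitude by simp
  then have "\<bar>u\<bar> powr p \<le> M powr p" using lam by simp
  then have "\<bar>u\<bar> \<le> M"
    using powr_less_mono2[of p M "\<bar>u\<bar>"] p amplitude_pos by linarith
  then show ?thesis using amplitude_pos by simp
qed

text \<open>Let x = u/M and let z be a u'. The energy identity reads (p-1) z^p = lam M^p (1 -
  |x|^p), so the arcsine density at x is a constant times M/z, while x' = z/(a M). The unknown z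
  cancels in the chain rule, and the phase has a slope that is the same for all solutions.\<close>

lemma arcsin_p_phase_derivative:
  assumes ab: "a > 0" "b > 0" and w: "w t > 0"
    and en: "asym_energy p a b lam (u t) (w t) = E"
    and du: "(u has_real_derivative flux_inv p a b (w t)) (at t)"
  shows "((\<lambda>t. arcsin_p p (u t / M)) has_real_derivative (lam / (p - 1)) powr (1 / p) / a) (at t)"
proof -
  define z where "z = (w t / a) powr (1 / (p - 1))"
  define x where "x = u t / M"
  define c where "c = (p - 1) / lam"
  have z: "z > 0" using w ab by (simp add: z_def)
  have c: "c > 0" using p lam by (simp add: c_def)
  have "\<bar>u t\<bar> powr p = M powr p * \<bar>x\<bar> powr p"
    using amplitude_pos by (simp add: x_def abs_mult powr_divide)
  then have "(p - 1) * z powr p + lam * (M powr p * \<bar>x\<bar> powr p) = lam * M powr p"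
    using en asym_energy_pos_flux[OF p ab(1) w, of b lam "u t"] energy_eq_amplitude by (simp add: z_def)
  then have "(p - 1) * z powr p = lam * M powr p * (1 - \<bar>x\<bar> powr p)" by (simp add: algebra_simps)
  then have "1 - \<bar>x\<bar> powr p = c * (z / M) powr p"
    using amplitude_pos lam z by (simp add: c_def powr_divide field_simps)
  then have dens: "1 - \<bar>x\<bar> powr p > 0" and
    "arcsin_density p x = (c * (z / M) powr p) powr (- 1 / p)"
    using c z amplitude_pos by (auto simp: arcsin_density_def)
  note this(2)
  also have "\<dots> = c powr (- 1 / p) * (z / M) powr (p * (- 1 / p))"
    using c z amplitude_pos by (subst powr_mult) (auto simp: powr_powr)
  also have "\<dots> = (lam / (p - 1)) powr (1 / p) * (M / z)"
    using c z amplitude_pos p lam by (simp add: powr_minus c_def powr_divide field_simps)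
  finally have density: "arcsin_density p x = (lam / (p - 1)) powr (1 / p) * (M / z)" .
  have "\<bar>x\<bar> < 1"
  proof (rule ccontr)
    assume "\<not> \<bar>x\<bar> < 1"
    then have "1 powr p \<le> \<bar>x\<bar> powr p" using p by (intro powr_mono2) auto
    with dens show False by simp
  qed
  then have "((\<lambda>t. arcsin_p p (u t / M)) has_real_derivative
      arcsin_density p x * (flux_inv p a b (w t) / M)) (at t)"
    unfolding x_def
    by (rule DERIV_chain2[OF has_real_derivative_arcsin_p[OF p] DERIV_cdivide[OF du]])
  moreover have "flux_inv p a b (w t) = z / a"
    using w ab by (simp add: flux_inv_def z_def)
  ultimately show ?thesis
    using density z amplitude_pos by simp
qed

text \<open>The two phases have equal slope, so their difference keeps its value from T. Only
  continuity is used at T, where the flux may vanish and the density is singular. Equal phases give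
  equal u, and the energy then determines the positive flux.\<close>

lemma asym_sol_agree_pos_flux:
  assumes ab: "a > 0" "b > 0"
    and sol1: "asym_sol p a b L lam u1 w1" and sol2: "asym_sol p a b L lam u2 w2"
    and en1: "\<And>t. t \<in> {0..L} \<Longrightarrow> asym_energy p a b lam (u1 t) (w1 t) = E"
    and en2: "\<And>t. t \<in> {0..L} \<Longrightarrow> asym_energy p a b lam (u2 t) (w2 t) = E"
    and T: "0 \<le> T" "T < t" "t < L" and eq: "u1 T = u2 T"
    and pos: "\<And>s. T < s \<Longrightarrow> s \<le> t \<Longrightarrow> w1 s > 0 \<and> w2 s > 0"
  shows "u1 t = u2 t \<and> w1 t = w2 t"
proof -
  define D where "D s = arcsin_p p (u1 s / M) - arcsin_p p (u2 s / M)" for s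
  have sub: "{T..t} \<subseteq> {0..L}" using T by auto
  have cont: "continuous_on {T..t} (\<lambda>s. arcsin_p p (u s / M))"
    if "asym_sol p a b L lam u w" "\<And>t. t \<in> {0..L} \<Longrightarrow> asym_energy p a b lam (u t) (w t) = E" for u w
  proof (rule continuous_on_compose2[OF continuous_on_arcsin_p[OF p]])
    show "continuous_on {T..t} (\<lambda>s. u s / M)"
      using continuous_on_subset[OF asym_sol_continuous(1)[OF that(1)] sub] amplitude_pos
      by (intro continuous_intros) auto
    show "(\<lambda>s. u s / M) ` {T..t} \<subseteq> {- 1..1}"
    proof
      fix x assume "x \<in> (\<lambda>s. u s / M) ` {T..t}"
      then obtain s where "s \<in> {T..t}" "x = u s / M" by blast
      then have "s \<in> {0..L}" "x = u s / M" using sub by auto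
      then show "x \<in> {- 1..1}" using abs_quotient_le_1[OF that(2)[of s]] unfolding abs_le_iff by simp
    qed
  qed
  have der: "((\<lambda>s. arcsin_p p (u s / M)) has_real_derivative (lam / (p - 1)) powr (1 / p) / a) (at s)"
    if "asym_sol p a b L lam u w" "\<And>t. t \<in> {0..L} \<Longrightarrow> asym_energy p a b lam (u t) (w t) = E"
      "T < s" "s < t" "w s > 0" for u w s
  proof (rule arcsin_p_phase_derivative[where u = u and w = w and t = s, OF ab that(5)])
    have s: "s \<in> {0..L}" using that T by simp
    show "asym_energy p a b lam (u s) (w s) = E" by (rule that(2)[OF s])
    have "at s within {0..L} = at s" using that T by (intro at_within_interior) auto
    then show "(u has_real_derivative flux_inv p a b (w s)) (at s)"
      using that(1)[unfolded asym_sol_def, rule_format, OF s] by simp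
  qed
  have "D t = D T"
  proof (rule DERIV_isconst_end[where f = D])
    show "continuous_on {T..t} D"
      unfolding D_def by (intro continuous_intros cont[OF sol1 en1] cont[OF sol2 en2])
    show "(D has_real_derivative 0) (at s)" if s: "T < s" "s < t" for s
    proof -
      have "w1 s > 0" "w2 s > 0" using pos[of s] s by auto
      then show ?thesis
        using DERIV_diff[OF der[OF sol1 en1 s] der[OF sol2 en2 s]] unfolding D_def by simp
    qed
  qed (use T in auto)
  then have "arcsin_p p (u1 t / M) = arcsin_p p (u2 t / M)" by (simp add: D_def eq)
  moreover have "\<bar>u1 t / M\<bar> \<le> 1" "\<bar>u2 t / M\<bar> \<le> 1"
    using T by (auto intro!: abs_quotient_le_1[OF en1] abs_quotient_le_1[OF en2] simp del: abs_divide)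
  ultimately have "u1 t / M = u2 t / M"
    using sin_p_arcsin_p[OF p] by metis
  then have u: "u1 t = u2 t" using amplitude_pos by simp
  have w: "w1 t > 0" "w2 t > 0" using pos[of t] T by auto
  have "asym_energy p a b lam (u1 t) (w1 t) = asym_energy p a b lam (u2 t) (w2 t)"
    using en1[of t] en2[of t] T by simp
  then have "(w1 t / a) powr (p / (p - 1)) = (w2 t / a) powr (p / (p - 1))"
    using w p u by (simp add: asym_energy_def)
  then have "w1 t / a = w2 t / a"
    by (rule powr_base_inject[rotated 3]) (use p w ab in auto)
  then show ?thesis using u ab by simp
qed

lemma asym_sol_flux_pos_right:
  assumes sol: "asym_sol p a b L lam u w" and T: "0 \<le> T" "T < L"
    and pos: "w T > 0 \<or> w T = 0 \<and> u T < 0"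
  obtains T' where "T < T'" "T' \<le> L" "\<And>t. T < t \<Longrightarrow> t < T' \<Longrightarrow> w t > 0"
proof -
  have "\<exists>d>0. \<forall>t. T < t \<and> t < T + d \<and> t \<le> L \<longrightarrow> w t > 0"
    using pos
  proof
    assume wT: "w T > 0"
    have "continuous (at T within {0..L}) w"
      using asym_sol_continuous(2)[OF sol] T by (simp add: continuous_on_eq_continuous_within)
    then obtain d where d: "d > 0" "\<And>t. t \<in> {0..L} \<Longrightarrow> dist t T < d \<Longrightarrow> dist (w t) (w T) < w T"
      using wT unfolding continuous_within_eps_delta by metis
    have "w t > 0" if "T < t" "t < T + d" "t \<le> L" for t
      using d(2)[of t] that T by (simp add: dist_real_def)
    then show ?thesis using d(1) by auto
  next
    assume wT: "w T = 0 \<and> u T < 0"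
    have "(w has_real_derivative - lam * (\<bar>u T\<bar> powr (p - 2) * u T)) (at T within {0..L})"
      using sol T by (simp add: asym_sol_def)
    moreover have "- lam * (\<bar>u T\<bar> powr (p - 2) * u T) > 0"
      using wT lam by (simp add: mult_less_0_iff zero_less_mult_iff)
    ultimately obtain d where d: "d > 0" "\<And>h. h > 0 \<Longrightarrow> T + h \<in> {0..L} \<Longrightarrow> h < d \<Longrightarrow> w T < w (T + h)"
      using has_real_derivative_pos_inc_right by blast
    have "w t > 0" if "T < t" "t < T + d" "t \<le> L" for t
      using d(2)[of "t - T"] that wT T by simp
    then show ?thesis using d(1) by auto
  qed
  then obtain d where d: "d > 0" "\<And>t. T < t \<Longrightarrow> t < T + d \<Longrightarrow> t \<le> L \<Longrightarrow> w t > 0" by auto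
  show ?thesis
    by (rule that[of "min (T + d) L"]) (use d T in auto)
qed

lemma asym_sol_agree_right_aux:
  assumes ab: "a > 0" "b > 0"
    and sol1: "asym_sol p a b L lam u1 w1" and sol2: "asym_sol p a b L lam u2 w2"
    and en1: "\<And>t. t \<in> {0..L} \<Longrightarrow> asym_energy p a b lam (u1 t) (w1 t) = E"
    and en2: "\<And>t. t \<in> {0..L} \<Longrightarrow> asym_energy p a b lam (u2 t) (w2 t) = E"
    and T: "0 \<le> T" "T < L" and eq: "u1 T = u2 T" "w1 T = w2 T"
    and pos: "w1 T > 0 \<or> w1 T = 0 \<and> u1 T < 0"
  shows "\<exists>T'>T. T' \<le> L \<and> (\<forall>t. T < t \<and> t < T' \<longrightarrow> u1 t = u2 t \<and> w1 t = w2 t)"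
proof -
  obtain T1 where T1: "T < T1" "T1 \<le> L" "\<And>t. T < t \<Longrightarrow> t < T1 \<Longrightarrow> w1 t > 0"
    using asym_sol_flux_pos_right[OF sol1 T pos] by blast
  obtain T2 where T2: "T < T2" "T2 \<le> L" "\<And>t. T < t \<Longrightarrow> t < T2 \<Longrightarrow> w2 t > 0"
    using asym_sol_flux_pos_right[OF sol2 T] pos eq by auto
  have "u1 t = u2 t \<and> w1 t = w2 t" if "T < t" "t < min T1 T2" for t
    by (rule asym_sol_agree_pos_flux[OF ab sol1 sol2 en1 en2 T(1) _ _ eq(1)])
       (use that T T1 T2 in auto)
  then show ?thesis using T1 T2 by (intro exI[of _ "min T1 T2"]) auto
qed

lemma asym_sol_agree_right:
  assumes ab: "a > 0" "b > 0"
    and sol1: "asym_sol p a b L lam u1 w1" and sol2: "asym_sol p a b L lam u2 w2"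
    and en1: "\<And>t. t \<in> {0..L} \<Longrightarrow> asym_energy p a b lam (u1 t) (w1 t) = E"
    and en2: "\<And>t. t \<in> {0..L} \<Longrightarrow> asym_energy p a b lam (u2 t) (w2 t) = E"
    and T: "0 \<le> T" "T < L" and eq: "u1 T = u2 T" "w1 T = w2 T"
  shows "\<exists>T'>T. T' \<le> L \<and> (\<forall>t. T < t \<and> t < T' \<longrightarrow> u1 t = u2 t \<and> w1 t = w2 t)"
proof (cases "w1 T > 0 \<or> w1 T = 0 \<and> u1 T < 0")
  case True
  then show ?thesis
    by (intro asym_sol_agree_right_aux[OF ab sol1 sol2 en1 en2 T eq]) auto
next
  case False
  \<comment> \<open>Positive energy excludes the origin of the phase plane; every other point
    satisfies the condition of the first case or its mirror image under (u, w) to (-u, -w).\<close>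
  have "\<not> (w1 T = 0 \<and> u1 T = 0)"
    using en1[of T] T E by (auto simp: asym_energy_def)
  then have "- w1 T > 0 \<or> - w1 T = 0 \<and> - u1 T < 0" using False by auto
  then have "\<exists>T'>T. T' \<le> L \<and> (\<forall>t. T < t \<and> t < T' \<longrightarrow> - u1 t = - u2 t \<and> - w1 t = - w2 t)"
    by (intro asym_sol_agree_right_aux[where a = b and b = a and L = L] asym_sol_minus sol1 sol2 ab T)
       (use en1 en2 eq in \<open>auto simp: asym_energy_minus\<close>)
  then show ?thesis by simp
qed

end

lemma asym_sol_unique:
  assumes p: "p > 1" and ab: "a > 0" "b > 0" and lam: "lam > 0"
    and sol1: "asym_sol p a b L lam u1 w1" and sol2: "asym_sol p a b L lam u2 w2"
    and eq: "u1 0 = u2 0" "w1 0 = w2 0" and nz: "w1 0 \<noteq> 0" and t: "t \<in> {0..L}"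
  shows "u1 t = u2 t"
proof (rule ccontr)
  assume ne: "u1 t \<noteq> u2 t"
  define E where "E = asym_energy p a b lam (u1 0) (w1 0)"
  have "(max (w1 0) 0 / a) powr (p / (p - 1)) + (max (- w1 0) 0 / b) powr (p / (p - 1)) > 0"
    using nz ab by (cases "w1 0 > 0") (auto simp: max_def)
  moreover have "lam * \<bar>u1 0\<bar> powr p \<ge> 0" using lam by simp
  ultimately have E: "E > 0"
    using p unfolding E_def asym_energy_def by (smt (verit) mult_pos_pos)
  have en1: "asym_energy p a b lam (u1 t) (w1 t) = E" if "t \<in> {0..L}" for t
    unfolding E_def by (rule asym_energy_const[OF p ab sol1 that])
  have en2: "asym_energy p a b lam (u2 t) (w2 t) = E" if "t \<in> {0..L}" for t
    unfolding E_def eq by (rule asym_energy_const[OF p ab sol2 that])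
  \<comment> \<open>All times of agreement up to t, not just an initial segment: its maximum T
    suffices, since agreement at T extends to the right of T.\<close>
  define A where "A = {s \<in> {0..t}. \<bar>u1 s - u2 s\<bar> + \<bar>w1 s - w2 s\<bar> = 0}"
  have sub: "{0..t} \<subseteq> {0..L}" using t by auto
  have "continuous_on {0..t} (\<lambda>s. \<bar>u1 s - u2 s\<bar> + \<bar>w1 s - w2 s\<bar>)"
    by (intro continuous_intros continuous_on_subset[OF asym_sol_continuous(1)[OF sol1] sub]
        continuous_on_subset[OF asym_sol_continuous(2)[OF sol1] sub]
        continuous_on_subset[OF asym_sol_continuous(1)[OF sol2] sub]
        continuous_on_subset[OF asym_sol_continuous(2)[OF sol2] sub])
  then have "closed A"
    unfolding A_def by (intro continuous_closed_preimage_constant) auto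
  then have "compact A"
    unfolding compact_eq_bounded_closed
    by (auto simp: A_def intro: bounded_subset[OF bounded_closed_interval[of 0 t]])
  moreover have "0 \<in> A" using t eq by (auto simp: A_def)
  ultimately obtain T where T: "T \<in> A" "\<And>s. s \<in> A \<Longrightarrow> s \<le> T"
    using compact_attains_sup[of A] by auto
  have T0: "0 \<le> T" "T \<le> t" "u1 T = u2 T" "w1 T = w2 T" using T(1) by (auto simp: A_def)
  then have "T < t" using ne by (cases "T = t") auto
  then have "T < L" using t by auto
  then obtain T' where T': "T < T'" "\<And>s. T < s \<Longrightarrow> s < T' \<Longrightarrow> u1 s = u2 s \<and> w1 s = w2 s"
    using asym_sol_agree_right[OF p lam E refl ab sol1 sol2 en1 en2 T0(1) _ T0(3,4)] by blast
  define s where "s = (T + min T' t) / 2"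
  have s: "T < s" "s < T'" "s < t" using T' \<open>T < t\<close> by (auto simp: s_def min_def field_simps)
  then have "s \<in> A" using T'(2)[of s] T0 by (auto simp: A_def)
  with T(2) s show False by force
qed

section \<open>The periodic wave\<close>

text \<open>The reduction modulo 2 is the one in \<open>phi_ab\<close>, so that the two periodic
  functions can be compared on a single period.\<close>

definition periodic2 :: "(real \<Rightarrow> real) \<Rightarrow> real \<Rightarrow> real" where
  "periodic2 f t = f (t - 2 * of_int \<lfloor>t / 2\<rfloor>)"

lemma periodic2_eq:
  assumes "2 * of_int n \<le> t" "t < 2 * of_int n + 2"
  shows "periodic2 f t = f (t - 2 * of_int n)"
proof -
  have "\<lfloor>t / 2\<rfloor> = n" using assms by (intro floor_unique) auto
  then show ?thesis by (simp add: periodic2_def)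
qed

lemma has_real_derivative_Icc_shift:
  fixes f :: "real \<Rightarrow> real"
  assumes "(f has_real_derivative D) (at (t - c) within {0..2})"
  shows "((\<lambda>s. f (s - c)) has_real_derivative D) (at t within {c..c + 2})"
proof -
  have "(\<lambda>s. s - c) ` {c..c + 2} = {0..2}"
    by (simp add: image_diff_atLeastAtMost[of c])
  then have "(f \<circ> (\<lambda>s. s - c) has_real_derivative D * 1) (at t within {c..c + 2})"
    using assms by (intro DERIV_image_chain) (auto intro!: derivative_eq_intros)
  then show ?thesis by (simp add: o_def)
qed

text \<open>At an even integer the one-sided derivatives come from different copies of f, at 0 from
  the right and at 2 from the left; the boundary hypotheses make them fit.\<close>

lemma has_real_derivative_periodic2:
  fixes f f' :: "real \<Rightarrow> real"
  assumes f: "\<And>t. t \<in> {0..2} \<Longrightarrow> (f has_real_derivative f' t) (at t within {0..2})"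
    and bd: "f 0 = f 2" "f' 0 = f' 2"
  shows "(periodic2 f has_real_derivative periodic2 f' t) (at t)"
proof -
  define n where "n = \<lfloor>t / 2\<rfloor>"
  define r where "r = t - 2 * of_int n"
  have r: "0 \<le> r" "r < 2" using floor_correct[of "t / 2", folded n_def] unfolding r_def by linarith+
  have val: "periodic2 f' t = f' r" by (simp add: periodic2_def r_def n_def)
  show ?thesis
  proof (cases "r = 0")
    case False
    have "((\<lambda>s. f (s - 2 * of_int n)) has_real_derivative f' r) (at t within {2 * of_int n..2 * of_int n + 2})"
      by (rule has_real_derivative_Icc_shift) (use f[of r] r in \<open>auto simp: r_def\<close>)
    moreover have "at t within {2 * of_int n..2 * of_int n + 2} = at t"
      by (rule at_within_interior) (use r False in \<open>auto simp: r_def\<close>)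
    ultimately have "((\<lambda>s. f (s - 2 * of_int n)) has_real_derivative f' r) (at t)" by simp
    then have "(periodic2 f has_real_derivative f' r) (at t)"
    proof (rule has_field_derivative_transform_within_open[where S = "{2 * of_int n<..<2 * of_int n + 2}"])
      show "f (s - 2 * of_int n) = periodic2 f s" if "s \<in> {2 * of_int n<..<2 * of_int n + 2}" for s
        using that periodic2_eq[of n s f] by simp
    qed (use r False in \<open>auto simp: r_def\<close>)
    then show ?thesis by (simp add: val)
  next
    case True
    then have t: "t = 2 * of_int n" by (simp add: r_def)
    have "((\<lambda>s. f (s - t)) has_real_derivative f' 0) (at t within {t..t + 2})"
      by (rule has_real_derivative_Icc_shift) (use f[of 0] in auto)
    then have R: "(periodic2 f has_real_derivative f' 0) (at t within {t..t + 2})"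
    proof (rule has_field_derivative_transform_within[where d = 2])
      fix s assume "s \<in> {t..t + 2}" "dist s t < 2"
      then show "f (s - t) = periodic2 f s"
        using periodic2_eq[of n s f] by (simp add: t dist_real_def)
    qed auto
    have "((\<lambda>s. f (s - (t - 2))) has_real_derivative f' 2) (at t within {t - 2..t - 2 + 2})"
      by (rule has_real_derivative_Icc_shift) (use f[of 2] in auto)
    then have "(periodic2 f has_real_derivative f' 2) (at t within {t - 2..t - 2 + 2})"
    proof (rule has_field_derivative_transform_within[where d = 2])
      fix s assume s: "s \<in> {t - 2..t - 2 + 2}" "dist s t < 2"
      show "f (s - (t - 2)) = periodic2 f s"
      \<comment> \<open>At the right end of the previous period the shifted copy takes the value
        \<open>f 2\<close>, while \<open>periodic2\<close> already restarts with
        \<open>f 0\<close>.\<close>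
      proof (cases "s = t")
        case True
        then show ?thesis using bd periodic2_eq[of n s f] by (simp add: t)
      next
        case False
        then show ?thesis using s periodic2_eq[of "n - 1" s f] by (simp add: t dist_real_def)
      qed
    qed auto
    then have L: "(periodic2 f has_real_derivative f' 0) (at t within {t - 2..t})" using bd by simp
    have "((\<lambda>y. (periodic2 f y - periodic2 f t) / (y - t)) \<longlongrightarrow> f' 0)
        (at t within {t - 2..t} \<union> {t..t + 2})"
      unfolding at_within_union
      by (rule filterlim_sup) (use L R in \<open>simp_all add: has_field_derivative_iff\<close>)
    moreover have "at t within {t - 2..t} \<union> {t..t + 2} = at t"
    proof -
      have "{t - 2..t} \<union> {t..t + 2} = {t - 2..t + 2}" by auto
      moreover have "at t within {t - 2..t + 2} = at t" by (rule at_within_interior) simp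
      ultimately show ?thesis by simp
    qed
    ultimately show ?thesis using True by (simp add: val has_field_derivative_iff)
  qed
qed

lemma has_real_derivative_Icc_from_interior:
  fixes f f' :: "real \<Rightarrow> real"
  assumes "finite S" and cf: "continuous_on {x..y} f" and cf': "continuous_on {x..y} f'"
    and D: "\<And>t. t \<in> {x<..<y} - S \<Longrightarrow> (f has_real_derivative f' t) (at t)" and t: "t \<in> {x..y}"
  shows "(f has_real_derivative f' t) (at t within {x..y})"
proof -
  have eq: "f s = f x + integral {x..s} f'" if "s \<in> {x..y}" for s
  proof -
    have "(f' has_integral (f s - f x)) {x..s}"
    proof (rule fundamental_theorem_of_calculus_interior_strong[OF assms(1)])
      show "(f has_vector_derivative f' r) (at r)" if "r \<in> {x<..<s} - S" for r
        using D[of r] that \<open>s \<in> {x..y}\<close> by (simp add: has_real_derivative_iff_has_vector_derivative)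
      show "continuous_on {x..s} f" by (rule continuous_on_subset[OF cf]) (use that in auto)
    qed (use that in auto)
    then show ?thesis by (simp add: integral_unique)
  qed
  have "((\<lambda>s. f x + integral {x..s} f') has_real_derivative 0 + f' t) (at t within {x..y})"
    by (intro DERIV_add DERIV_const integral_has_real_derivative cf' t)
  then have "((\<lambda>s. f x + integral {x..s} f') has_real_derivative f' t) (at t within {x..y})" by simp
  then show ?thesis
    by (rule has_field_derivative_transform_within[OF _ zero_less_one t]) (rule eq[symmetric])
qed

lemma continuous_on_Icc_three_pieces:
  fixes f :: "real \<Rightarrow> real"
  assumes "x \<le> y" "y \<le> z" "z \<le> w"
    and "continuous_on {x..y} f1" "continuous_on {y..z} f2" "continuous_on {z..w} f3"
    and "\<And>t. t \<in> {x..y} \<Longrightarrow> f t = f1 t" "\<And>t. t \<in> {y..z} \<Longrightarrow> f t = f2 t"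
      "\<And>t. t \<in> {z..w} \<Longrightarrow> f t = f3 t"
  shows "continuous_on {x..w} f"
proof -
  have "continuous_on {x..y} f" "continuous_on {y..z} f" "continuous_on {z..w} f"
    using assms by (auto intro: continuous_on_eq[OF assms(4)] continuous_on_eq[OF assms(5)]
        continuous_on_eq[OF assms(6)])
  then have "continuous_on ({x..y} \<union> {y..z} \<union> {z..w}) f"
    by (intro continuous_on_closed_Un) auto
  moreover have "{x..y} \<union> {y..z} \<union> {z..w} = {x..w}" using assms(1-3) by auto
  ultimately show ?thesis by simp
qed

text \<open>The (p-1)-st power of the derivative of \<open>sin_p\<close>, so that it is proportional
  to the flux on each branch.\<close>

definition cos_p :: "real \<Rightarrow> real \<Rightarrow> real" where
  "cos_p p y = (1 - \<bar>sin_p p y\<bar> powr p) powr ((p - 1) / p)"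

text \<open>A triangular wave with zeros at 0, 1, 2 and extreme values pi_p/2 and -pi_p/2 at t0 and
  2 - t0. With t0 = a/(a+b) its slopes are proportional to 1/a and -1/b.\<close>

definition wave_phase :: "real \<Rightarrow> real \<Rightarrow> real \<Rightarrow> real \<Rightarrow> real" where
  "wave_phase p a b t =
     (if t \<le> t0_ab a b then pi_p p / 2 * (t / t0_ab a b)
      else if t \<le> 2 - t0_ab a b then pi_p p / 2 * ((1 - t) / (1 - t0_ab a b))
      else pi_p p / 2 * ((t - 2) / t0_ab a b))"

definition wave :: "real \<Rightarrow> real \<Rightarrow> real \<Rightarrow> real \<Rightarrow> real" where
  "wave p a b t = sin_p p (wave_phase p a b t)"

text \<open>Put kappa = (pi_p/2)(a+b). On a rising branch u' is kappa/a times the derivative of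
  \<open>sin_p\<close>, and a^p (kappa/a)^(p-1) = a kappa^(p-1); falling branches give -b in the
  same way.\<close>

definition wave_flux :: "real \<Rightarrow> real \<Rightarrow> real \<Rightarrow> real \<Rightarrow> real" where
  "wave_flux p a b t =
     (if t \<le> t0_ab a b \<or> 2 - t0_ab a b \<le> t then a else - b)
       * (pi_p p / 2 * (a + b)) powr (p - 1) * cos_p p (wave_phase p a b t)"

context
  fixes p :: real
  assumes p: "p > 1"
begin

lemma abs_pi_half_mult_le: "\<bar>x\<bar> \<le> 1 \<Longrightarrow> \<bar>pi_p p / 2 * x\<bar> \<le> pi_p p / 2"
  using pi_p_pos[OF p] by (simp add: abs_mult)

lemma abs_pi_half_mult_less: "\<bar>x\<bar> < 1 \<Longrightarrow> \<bar>pi_p p / 2 * x\<bar> < pi_p p / 2"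
  using pi_p_pos[OF p] by (simp add: abs_mult)

lemma continuous_on_sin_p_compose:
  assumes "continuous_on A y" "\<And>t. t \<in> A \<Longrightarrow> \<bar>y t\<bar> \<le> 1"
  shows "continuous_on A (\<lambda>t. sin_p p (pi_p p / 2 * y t))"
proof (rule continuous_on_compose2[OF continuous_on_sin_p[OF p]])
  show "(\<lambda>t. pi_p p / 2 * y t) ` A \<subseteq> {- pi_p p / 2..pi_p p / 2}"
  proof (rule image_subsetI)
    fix t assume "t \<in> A"
    from abs_pi_half_mult_le[OF assms(2)[OF this]]
    show "pi_p p / 2 * y t \<in> {- pi_p p / 2..pi_p p / 2}" unfolding abs_le_iff by simp
  qed
qed (intro continuous_intros assms)

lemma continuous_on_cos_p_compose:
  assumes "continuous_on A y" "\<And>t. t \<in> A \<Longrightarrow> \<bar>y t\<bar> \<le> 1"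
  shows "continuous_on A (\<lambda>t. cos_p p (pi_p p / 2 * y t))"
  unfolding cos_p_def
proof (intro continuous_on_powr' continuous_intros continuous_on_sin_p_compose assms ballI)
  fix t assume "t \<in> A"
  then have "\<bar>sin_p p (pi_p p / 2 * y t)\<bar> \<le> 1"
    by (intro abs_sin_p_le_1[OF p] abs_pi_half_mult_le assms(2))
  then show "0 \<le> 1 - \<bar>sin_p p (pi_p p / 2 * y t)\<bar> powr p \<and>
      (1 - \<bar>sin_p p (pi_p p / 2 * y t)\<bar> powr p = 0 \<longrightarrow> 0 < (p - 1) / p)"
    using abs_powr_le_1[of p] p by simp
qed (use p in auto)

lemma cos_p_pi_half: "cos_p p (pi_p p / 2) = 0" "cos_p p (- (pi_p p / 2)) = 0"
proof -
  have "sin_p p (- (pi_p p / 2)) = - sin_p p (pi_p p / 2)"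
    by (rule sin_p_minus[OF p]) (use pi_p_pos[OF p] in simp)
  then show "cos_p p (pi_p p / 2) = 0" "cos_p p (- (pi_p p / 2)) = 0"
    unfolding cos_p_def by (simp_all add: sin_p_pi_half[OF p])
qed

lemma flux_inv_eval:
  assumes "a > 0" "b > 0" "\<kappa> > 0" "c \<ge> 0"
  shows "flux_inv p a b (a * \<kappa> powr (p - 1) * c powr ((p - 1) / p)) = \<kappa> / a * c powr (1 / p)"
proof -
  have "(c powr ((p - 1) / p)) powr (1 / (p - 1)) = c powr (1 / p)"
    using p by (simp add: powr_powr)
  moreover have "max (a * \<kappa> powr (p - 1) * c powr ((p - 1) / p)) 0 = a * \<kappa> powr (p - 1) * c powr ((p - 1) / p)"
    "max (- (a * \<kappa> powr (p - 1) * c powr ((p - 1) / p))) 0 = 0"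
    using assms by (auto simp: max_absorb1 max_absorb2)
  ultimately show ?thesis
    using assms p powr_inverse_cancel(1)[of "p - 1" \<kappa>] by (simp add: flux_inv_def powr_mult)
qed

lemma has_real_derivative_sin_p_affine:
  assumes "\<bar>m * t + n\<bar> < 1"
  shows "((\<lambda>t. sin_p p (pi_p p / 2 * (m * t + n))) has_real_derivative
      (1 - \<bar>sin_p p (pi_p p / 2 * (m * t + n))\<bar> powr p) powr (1 / p) * (pi_p p / 2 * m)) (at t)"
    and "((\<lambda>t. cos_p p (pi_p p / 2 * (m * t + n))) has_real_derivative
      - (p - 1) * (\<bar>sin_p p (pi_p p / 2 * (m * t + n))\<bar> powr (p - 2)
          * sin_p p (pi_p p / 2 * (m * t + n))) * (pi_p p / 2 * m)) (at t)"
proof -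
  have y: "((\<lambda>t. pi_p p / 2 * (m * t + n)) has_real_derivative pi_p p / 2 * m) (at t)"
    by (auto intro!: derivative_eq_intros)
  show "((\<lambda>t. sin_p p (pi_p p / 2 * (m * t + n))) has_real_derivative
      (1 - \<bar>sin_p p (pi_p p / 2 * (m * t + n))\<bar> powr p) powr (1 / p) * (pi_p p / 2 * m)) (at t)"
    by (rule DERIV_chain2[OF has_real_derivative_sin_p[OF p abs_pi_half_mult_less[OF assms]] y])
  show "((\<lambda>t. cos_p p (pi_p p / 2 * (m * t + n))) has_real_derivative
      - (p - 1) * (\<bar>sin_p p (pi_p p / 2 * (m * t + n))\<bar> powr (p - 2)
          * sin_p p (pi_p p / 2 * (m * t + n))) * (pi_p p / 2 * m)) (at t)"
    unfolding cos_p_def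
    by (rule DERIV_chain2[OF has_real_derivative_cos_p[OF p abs_pi_half_mult_less[OF assms]] y])
qed

end

section \<open>Continuity of the wave and of its flux\<close>

context
  fixes p a b :: real
  assumes p: "p > 1" and ab: "a > 0" "b > 0"
begin

lemma t0_bounds: "0 < t0_ab a b" "t0_ab a b < 1"
  using ab by (auto simp: t0_ab_def)

text \<open>The pieces are closed and overlap at the turning points, where neighbouring phases
  coincide; this is the form needed to glue continuous functions.\<close>

lemma wave_pieces:
  shows "t \<in> {0..t0_ab a b} \<Longrightarrow> wave p a b t = sin_p p (pi_p p / 2 * (t / t0_ab a b))"
    and "t \<in> {t0_ab a b..2 - t0_ab a b} \<Longrightarrow> wave p a b t = sin_p p (pi_p p / 2 * ((1 - t) / (1 - t0_ab a b)))"
    and "t \<in> {2 - t0_ab a b..2} \<Longrightarrow> wave p a b t = sin_p p (pi_p p / 2 * ((t - 2) / t0_ab a b))"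
proof -
  note t0 = t0_bounds
  show "wave p a b t = sin_p p (pi_p p / 2 * (t / t0_ab a b))" if "t \<in> {0..t0_ab a b}"
    using that by (simp add: wave_def wave_phase_def)
  show "wave p a b t = sin_p p (pi_p p / 2 * ((1 - t) / (1 - t0_ab a b)))"
    if "t \<in> {t0_ab a b..2 - t0_ab a b}"
    using that t0 by (cases "t = t0_ab a b") (auto simp: wave_def wave_phase_def)
  show "wave p a b t = sin_p p (pi_p p / 2 * ((t - 2) / t0_ab a b))" if "t \<in> {2 - t0_ab a b..2}"
  proof (cases "t = 2 - t0_ab a b")
    case True
    have "(1 - t) / (1 - t0_ab a b) = -1" "(t - 2) / t0_ab a b = -1"
      using t0 by (auto simp: True field_simps)
    then show ?thesis using t0 True by (simp add: wave_def wave_phase_def)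
  qed (use that t0 in \<open>auto simp: wave_def wave_phase_def\<close>)
qed

lemma wave_flux_pieces:
  fixes t :: real
  defines "\<kappa> \<equiv> pi_p p / 2 * (a + b)"
  shows "t \<in> {0..t0_ab a b} \<Longrightarrow>
      wave_flux p a b t = a * \<kappa> powr (p - 1) * cos_p p (pi_p p / 2 * (t / t0_ab a b))"
    and "t \<in> {t0_ab a b..2 - t0_ab a b} \<Longrightarrow>
      wave_flux p a b t = - b * \<kappa> powr (p - 1) * cos_p p (pi_p p / 2 * ((1 - t) / (1 - t0_ab a b)))"
    and "t \<in> {2 - t0_ab a b..2} \<Longrightarrow>
      wave_flux p a b t = a * \<kappa> powr (p - 1) * cos_p p (pi_p p / 2 * ((t - 2) / t0_ab a b))"
proof -
  note t0 = t0_bounds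
  show "wave_flux p a b t = a * \<kappa> powr (p - 1) * cos_p p (pi_p p / 2 * (t / t0_ab a b))"
    if "t \<in> {0..t0_ab a b}"
    using that by (simp add: wave_flux_def wave_phase_def \<kappa>_def)
  have s: "(1 - (2 - t0_ab a b)) / (1 - t0_ab a b) = -1" "(2 - t0_ab a b - 2) / t0_ab a b = -1"
    "(1 - t0_ab a b) / (1 - t0_ab a b) = 1" "t0_ab a b / t0_ab a b = 1"
    using t0 by (auto simp: field_simps)
  \<comment> \<open>Both neighbouring formulas give 0 at a turning point because
    \<open>cos_p\<close> vanishes there, so the jump of the factor from a to -b does no
    harm.\<close>
  have z: "wave_flux p a b (t0_ab a b) = 0" "wave_flux p a b (2 - t0_ab a b) = 0"
  proof -
    have "wave_phase p a b (2 - t0_ab a b) = pi_p p / 2 * ((1 - (2 - t0_ab a b)) / (1 - t0_ab a b))"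
      using t0 by (simp add: wave_phase_def)
    then show "wave_flux p a b (2 - t0_ab a b) = 0"
      unfolding wave_flux_def s using cos_p_pi_half[OF p] by simp
    show "wave_flux p a b (t0_ab a b) = 0"
      unfolding wave_flux_def wave_phase_def using cos_p_pi_half[OF p] t0 by simp
  qed
  show "wave_flux p a b t = - b * \<kappa> powr (p - 1) * cos_p p (pi_p p / 2 * ((1 - t) / (1 - t0_ab a b)))"
    if "t \<in> {t0_ab a b..2 - t0_ab a b}"
  proof -
    consider "t = t0_ab a b" | "t = 2 - t0_ab a b" | "t0_ab a b < t" "t < 2 - t0_ab a b"
      using \<open>t \<in> {t0_ab a b..2 - t0_ab a b}\<close> by fastforce
    then show ?thesis
    proof cases
      case 1
      then show ?thesis using z cos_p_pi_half[OF p] by (simp only: s) simp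
    next
      case 2
      then show ?thesis using z cos_p_pi_half[OF p] by (simp only: s) simp
    next
      case 3
      then show ?thesis by (simp add: wave_flux_def wave_phase_def \<kappa>_def)
    qed
  qed
  show "wave_flux p a b t = a * \<kappa> powr (p - 1) * cos_p p (pi_p p / 2 * ((t - 2) / t0_ab a b))"
    if "t \<in> {2 - t0_ab a b..2}"
  proof (cases "t = 2 - t0_ab a b")
    case True
    then show ?thesis using z cos_p_pi_half[OF p] by (simp only: s) simp
  next
    case False
    then have "2 - t0_ab a b < t" "t0_ab a b < t" using that t0 by auto
    then show ?thesis by (simp add: wave_flux_def wave_phase_def \<kappa>_def)
  qed
qed

lemma wave_phase_pieces_bound:
  shows "t \<in> {0..t0_ab a b} \<Longrightarrow> \<bar>t / t0_ab a b\<bar> \<le> 1"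
    and "t \<in> {t0_ab a b..2 - t0_ab a b} \<Longrightarrow> \<bar>(1 - t) / (1 - t0_ab a b)\<bar> \<le> 1"
    and "t \<in> {2 - t0_ab a b..2} \<Longrightarrow> \<bar>(t - 2) / t0_ab a b\<bar> \<le> 1"
proof -
  show "\<bar>t / t0_ab a b\<bar> \<le> 1" if "t \<in> {0..t0_ab a b}"
    using that t0_bounds by (simp add: abs_le_iff divide_simps)
  show "\<bar>(1 - t) / (1 - t0_ab a b)\<bar> \<le> 1" if "t \<in> {t0_ab a b..2 - t0_ab a b}"
    using that t0_bounds unfolding abs_divide by (simp add: divide_simps abs_le_iff)
  show "\<bar>(t - 2) / t0_ab a b\<bar> \<le> 1" if "t \<in> {2 - t0_ab a b..2}"
    using that t0_bounds unfolding abs_divide by (simp add: divide_simps abs_le_iff)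
qed

lemma continuous_on_wave: "continuous_on {0..2} (wave p a b)"
proof (rule continuous_on_Icc_three_pieces[of 0 "t0_ab a b" "2 - t0_ab a b" 2])
  note intros = continuous_on_sin_p_compose[OF p] continuous_on_divide continuous_on_diff
    continuous_on_id continuous_on_const
  show "continuous_on {0..t0_ab a b} (\<lambda>t. sin_p p (pi_p p / 2 * (t / t0_ab a b)))"
    "continuous_on {t0_ab a b..2 - t0_ab a b} (\<lambda>t. sin_p p (pi_p p / 2 * ((1 - t) / (1 - t0_ab a b))))"
    "continuous_on {2 - t0_ab a b..2} (\<lambda>t. sin_p p (pi_p p / 2 * ((t - 2) / t0_ab a b)))"
    by (intro intros wave_phase_pieces_bound; use t0_bounds in simp)+
  show "wave p a b t = sin_p p (pi_p p / 2 * (t / t0_ab a b))" if "t \<in> {0..t0_ab a b}" for t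
    by (rule wave_pieces(1)[OF that])
  show "wave p a b t = sin_p p (pi_p p / 2 * ((1 - t) / (1 - t0_ab a b)))"
    if "t \<in> {t0_ab a b..2 - t0_ab a b}" for t
    by (rule wave_pieces(2)[OF that])
  show "wave p a b t = sin_p p (pi_p p / 2 * ((t - 2) / t0_ab a b))" if "t \<in> {2 - t0_ab a b..2}" for t
    by (rule wave_pieces(3)[OF that])
qed (use t0_bounds in auto)

lemma continuous_on_wave_flux: "continuous_on {0..2} (wave_flux p a b)"
proof (rule continuous_on_Icc_three_pieces[of 0 "t0_ab a b" "2 - t0_ab a b" 2])
  note intros = continuous_on_cos_p_compose[OF p] continuous_on_divide continuous_on_diff
    continuous_on_id continuous_on_const continuous_on_mult
  define k where "k = (pi_p p / 2 * (a + b)) powr (p - 1)"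
  show "continuous_on {0..t0_ab a b} (\<lambda>t. a * k * cos_p p (pi_p p / 2 * (t / t0_ab a b)))"
    "continuous_on {t0_ab a b..2 - t0_ab a b} (\<lambda>t. - b * k * cos_p p (pi_p p / 2 * ((1 - t) / (1 - t0_ab a b))))"
    "continuous_on {2 - t0_ab a b..2} (\<lambda>t. a * k * cos_p p (pi_p p / 2 * ((t - 2) / t0_ab a b)))"
    by (intro intros wave_phase_pieces_bound; use t0_bounds in simp)+
  show "wave_flux p a b t = a * k * cos_p p (pi_p p / 2 * (t / t0_ab a b))"
    if "t \<in> {0..t0_ab a b}" for t
    using wave_flux_pieces(1)[OF that] by (simp add: k_def)
  show "wave_flux p a b t = - b * k * cos_p p (pi_p p / 2 * ((1 - t) / (1 - t0_ab a b)))"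
    if "t \<in> {t0_ab a b..2 - t0_ab a b}" for t
    using wave_flux_pieces(2)[OF that] by (simp add: k_def)
  show "wave_flux p a b t = a * k * cos_p p (pi_p p / 2 * ((t - 2) / t0_ab a b))"
    if "t \<in> {2 - t0_ab a b..2}" for t
    using wave_flux_pieces(3)[OF that] by (simp add: k_def)
qed (use t0_bounds in auto)

end

text \<open>The value of lam for which the full period (a+b) pi_p ((p-1)/lam)^(1/p) equals
  2.\<close>

definition wave_eigenvalue :: "real \<Rightarrow> real \<Rightarrow> real \<Rightarrow> real" where
  "wave_eigenvalue p a b = (p - 1) * (pi_p p / 2 * (a + b)) powr p"

lemma sin_p_pi_half_pos:
  assumes "p > 1" "0 < x" "x \<le> 1"
  shows "0 < sin_p p (pi_p p / 2 * x)"
  using assms pi_p_pos[OF assms(1)] by (intro sin_p_pos) (auto simp: mult_le_cancel_left1)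

section \<open>The wave and its rescalings solve the system\<close>

context
  fixes p a b :: real
  assumes p: "p > 1" and ab: "a > 0" "b > 0"
begin

lemma wave_eigenvalue_pos: "wave_eigenvalue p a b > 0"
  using p ab pi_p_pos[OF p] by (simp add: wave_eigenvalue_def)

text \<open>The signed weight \<sigma> treats rising and falling branches at once: the phase has
  slope \<kappa>/\<sigma> and the flux carries the factor \<sigma>, so \<sigma> cancels in the
  derivative of the flux and one eigenvalue serves all pieces.\<close>

lemma wave_piece_derivative:
  fixes \<sigma> m n x y t :: real
  defines "\<kappa> \<equiv> pi_p p / 2 * (a + b)"
  assumes \<sigma>: "\<sigma> = a \<or> \<sigma> = - b" and m: "pi_p p / 2 * m = \<kappa> / \<sigma>" and t: "t \<in> {x<..<y}"
    and bound: "\<bar>m * t + n\<bar> < 1"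
    and u: "\<And>s. s \<in> {x<..<y} \<Longrightarrow> wave p a b s = sin_p p (pi_p p / 2 * (m * s + n))"
    and w: "\<And>s. s \<in> {x<..<y} \<Longrightarrow>
      wave_flux p a b s = \<sigma> * \<kappa> powr (p - 1) * cos_p p (pi_p p / 2 * (m * s + n))"
  shows "(wave p a b has_real_derivative flux_inv p a b (wave_flux p a b t)) (at t)"
    and "(wave_flux p a b has_real_derivative
      - wave_eigenvalue p a b * (\<bar>wave p a b t\<bar> powr (p - 2) * wave p a b t)) (at t)"
proof -
  have \<kappa>: "\<kappa> > 0" using ab pi_p_pos[OF p] by (simp add: \<kappa>_def)
  have \<sigma>0: "\<sigma> \<noteq> 0" using \<sigma> ab by auto
  define c where "c = 1 - \<bar>wave p a b t\<bar> powr p"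
  have "\<bar>wave p a b t\<bar> \<le> 1"
    unfolding u[OF t] using abs_pi_half_mult_less[OF p bound] by (intro abs_sin_p_le_1[OF p]) simp
  then have c: "c \<ge> 0" using abs_powr_le_1[of p] p by (simp add: c_def)
  have flux: "wave_flux p a b t = \<sigma> * \<kappa> powr (p - 1) * c powr ((p - 1) / p)"
    by (simp only: w[OF t] cos_p_def c_def u[OF t])
  have inv: "flux_inv p a b (wave_flux p a b t) = c powr (1 / p) * (\<kappa> / \<sigma>)"
    using \<sigma>
  proof
    assume "\<sigma> = a"
    then show ?thesis using flux_inv_eval[OF p ab \<kappa> c] by (simp add: flux)
  next
    \<comment> \<open>A negative flux is inverted by evaluating the positive one with a and b
      exchanged.\<close>
    assume "\<sigma> = - b"
    then show ?thesis
      using flux_inv_eval[OF p ab(2,1) \<kappa> c]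
        flux_inv_minus[of p a b "b * \<kappa> powr (p - 1) * c powr ((p - 1) / p)"] by (simp add: flux)
  qed
  have "((\<lambda>s. sin_p p (pi_p p / 2 * (m * s + n))) has_real_derivative
      flux_inv p a b (wave_flux p a b t)) (at t)"
    using has_real_derivative_sin_p_affine(1)[OF p bound] unfolding inv c_def u[OF t] m .
  then show "(wave p a b has_real_derivative flux_inv p a b (wave_flux p a b t)) (at t)"
    by (rule has_field_derivative_transform_within_open[OF _ open_greaterThanLessThan t]) (rule u[symmetric])
  define h where "h = \<bar>wave p a b t\<bar> powr (p - 2) * wave p a b t"
  have "((\<lambda>s. \<sigma> * \<kappa> powr (p - 1) * cos_p p (pi_p p / 2 * (m * s + n))) has_real_derivative
      \<sigma> * \<kappa> powr (p - 1) * (- (p - 1) * h * (\<kappa> / \<sigma>))) (at t)"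
    by (rule DERIV_cmult)
       (use has_real_derivative_sin_p_affine(2)[OF p bound] in \<open>simp only: h_def u[OF t] m\<close>)
  also have "\<sigma> * \<kappa> powr (p - 1) * (- (p - 1) * h * (\<kappa> / \<sigma>)) = - wave_eigenvalue p a b * h"
  proof -
    have "\<kappa> powr p = \<kappa> powr (p - 1) * \<kappa>" using \<kappa> powr_pred[of \<kappa> p] by (simp add: field_simps)
    then have ev: "wave_eigenvalue p a b = (p - 1) * (\<kappa> powr (p - 1) * \<kappa>)"
      unfolding wave_eigenvalue_def \<kappa>_def[symmetric] by simp
    show ?thesis unfolding ev using \<sigma>0 by (simp add: algebra_simps)
  qed
  finally show "(wave_flux p a b has_real_derivative
      - wave_eigenvalue p a b * (\<bar>wave p a b t\<bar> powr (p - 2) * wave p a b t)) (at t)"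
    unfolding h_def
    by (rule has_field_derivative_transform_within_open[OF _ open_greaterThanLessThan t]) (rule w[symmetric])
qed

lemma wave_derivative:
  assumes t: "t \<in> {0<..<2} - {t0_ab a b, 2 - t0_ab a b}"
  shows "(wave p a b has_real_derivative flux_inv p a b (wave_flux p a b t)) (at t)"
    and "(wave_flux p a b has_real_derivative
      - wave_eigenvalue p a b * (\<bar>wave p a b t\<bar> powr (p - 2) * wave p a b t)) (at t)"
proof -
  define t0 where "t0 = t0_ab a b"
  have t0: "0 < t0" "t0 < 1" using t0_bounds[OF p ab] by (auto simp: t0_def)
  have eqs: "1 / t0 * s + 0 = s / t0" "- 1 / (1 - t0) * s + 1 / (1 - t0) = (1 - s) / (1 - t0)"
    "1 / t0 * s + - 2 / t0 = (s - 2) / t0" for s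
    by (simp_all add: diff_divide_distrib)
  \<comment> \<open>Here the choice of t0 enters: 1/t0 = (a+b)/a and 1/(1-t0) = (a+b)/b.\<close>
  have slopes: "pi_p p / 2 * (1 / t0) = pi_p p / 2 * (a + b) / a"
    "pi_p p / 2 * (- 1 / (1 - t0)) = pi_p p / 2 * (a + b) / - b"
    using ab by (auto simp: t0_def t0_ab_def field_simps)
  note wp = wave_pieces[OF p ab, folded t0_def]
  note wf = wave_flux_pieces[OF p ab, folded t0_def]
  consider "t \<in> {0<..<t0}" | "t \<in> {t0<..<2 - t0}" | "t \<in> {2 - t0<..<2}"
    using t by (force simp: t0_def)
  then have "(wave p a b has_real_derivative flux_inv p a b (wave_flux p a b t)) (at t) \<and>
    (wave_flux p a b has_real_derivative
      - wave_eigenvalue p a b * (\<bar>wave p a b t\<bar> powr (p - 2) * wave p a b t)) (at t)"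
  proof cases
    case 1
    have b: "\<bar>1 / t0 * t + 0\<bar> < 1" using 1 t0 by (simp add: field_simps)
    show ?thesis
      by (intro conjI; rule wave_piece_derivative[OF disjI1[OF refl] slopes(1) 1 b])
         (simp_all only: eqs, (intro wp(1) wf(1); simp)+)
  next
    case 2
    have "\<bar>1 - t\<bar> < 1 - t0" using 2 by (auto simp: abs_less_iff)
    then have b: "\<bar>- 1 / (1 - t0) * t + 1 / (1 - t0)\<bar> < 1"
      unfolding eqs abs_divide using t0 by simp
    show ?thesis
      by (intro conjI; rule wave_piece_derivative[OF disjI2[OF refl] slopes(2) 2 b])
         (simp_all only: eqs, (intro wp(2) wf(2); simp)+)
  next
    case 3
    have "\<bar>t - 2\<bar> < t0" using 3 by (auto simp: abs_less_iff)
    then have b: "\<bar>1 / t0 * t + - 2 / t0\<bar> < 1"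
      unfolding eqs abs_divide using t0 by simp
    show ?thesis
      by (intro conjI; rule wave_piece_derivative[OF disjI1[OF refl] slopes(1) 3 b])
         (simp_all only: eqs, (intro wp(3) wf(3); simp)+)
  qed
  then show "(wave p a b has_real_derivative flux_inv p a b (wave_flux p a b t)) (at t)"
    and "(wave_flux p a b has_real_derivative
      - wave_eigenvalue p a b * (\<bar>wave p a b t\<bar> powr (p - 2) * wave p a b t)) (at t)" by auto
qed

lemma wave_integer_values: "wave p a b 0 = 0" "wave p a b 1 = 0" "wave p a b 2 = 0"
  using wave_pieces(1)[OF p ab, of 0] wave_pieces(2)[OF p ab, of 1] wave_pieces(3)[OF p ab, of 2]
    t0_bounds[OF p ab] sin_p_0[OF p] by auto

lemma wave_flux_end_values:
  "wave_flux p a b 0 = a * (pi_p p / 2 * (a + b)) powr (p - 1)"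
  "wave_flux p a b 2 = a * (pi_p p / 2 * (a + b)) powr (p - 1)"
  using wave_flux_pieces(1)[OF p ab, of 0] wave_flux_pieces(3)[OF p ab, of 2]
    t0_bounds[OF p ab] sin_p_0[OF p] p by (auto simp: cos_p_def)

lemma periodic_wave_derivative:
  shows "(periodic2 (wave p a b) has_real_derivative
      flux_inv p a b (periodic2 (wave_flux p a b) t)) (at t)"
    and "(periodic2 (wave_flux p a b) has_real_derivative - wave_eigenvalue p a b *
      (\<bar>periodic2 (wave p a b) t\<bar> powr (p - 2) * periodic2 (wave p a b) t)) (at t)"
proof -
  note cu = continuous_on_wave[OF p ab] and cw = continuous_on_wave_flux[OF p ab]
  have "(periodic2 (wave p a b) has_real_derivative
      periodic2 (\<lambda>t. flux_inv p a b (wave_flux p a b t)) t) (at t)"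
    by (rule has_real_derivative_periodic2,
        rule has_real_derivative_Icc_from_interior[where S = "{t0_ab a b, 2 - t0_ab a b}"])
       (use wave_integer_values wave_flux_end_values in
         \<open>auto intro!: cu continuous_on_flux_inv[OF p ab] cw wave_derivative(1)\<close>)
  then show "(periodic2 (wave p a b) has_real_derivative
      flux_inv p a b (periodic2 (wave_flux p a b) t)) (at t)"
    by (simp only: periodic2_def)
  have "(periodic2 (wave_flux p a b) has_real_derivative
      periodic2 (\<lambda>t. - wave_eigenvalue p a b * (\<bar>wave p a b t\<bar> powr (p - 2) * wave p a b t)) t) (at t)"
    by (rule has_real_derivative_periodic2,
        rule has_real_derivative_Icc_from_interior[where S = "{t0_ab a b, 2 - t0_ab a b}"])
       (use wave_integer_values wave_flux_end_values wave_derivative(2) in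
         \<open>auto intro!: cw continuous_on_mult continuous_on_minus continuous_on_const continuous_on_odd_powr[OF p cu]\<close>)
  then show "(periodic2 (wave_flux p a b) has_real_derivative - wave_eigenvalue p a b *
      (\<bar>periodic2 (wave p a b) t\<bar> powr (p - 2) * periodic2 (wave p a b) t)) (at t)"
    by (simp only: periodic2_def)
qed

text \<open>Amplitude c and frequency \<omega> multiply u' by c \<omega>, hence the flux by (c
  \<omega>)^(p-1). Its derivative gains another \<omega>; after c^(p-1) is absorbed into |u|^(p-2)
  u, the eigenvalue is multiplied by \<omega>^p, whatever c is.\<close>

lemma asym_sol_wave:
  assumes c: "c > 0" and \<omega>: "\<omega> > 0"
  shows "asym_sol p a b L (\<omega> powr p * wave_eigenvalue p a b)
    (\<lambda>t. c * periodic2 (wave p a b) (\<omega> * t))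
    (\<lambda>t. (c * \<omega>) powr (p - 1) * periodic2 (wave_flux p a b) (\<omega> * t))"
  unfolding asym_sol_def
proof (intro ballI conjI)
  fix t
  have lin: "((\<lambda>t. \<omega> * t) has_real_derivative \<omega>) (at t within {0..L})"
    by (auto intro!: derivative_eq_intros)
  define u where "u = periodic2 (wave p a b) (\<omega> * t)"
  define w where "w = periodic2 (wave_flux p a b) (\<omega> * t)"
  have "((\<lambda>t. c * periodic2 (wave p a b) (\<omega> * t)) has_real_derivative
      c * (flux_inv p a b w * \<omega>)) (at t within {0..L})"
    unfolding w_def by (intro DERIV_cmult DERIV_chain2[OF periodic_wave_derivative(1) lin])
  moreover have "c * (flux_inv p a b w * \<omega>) = flux_inv p a b ((c * \<omega>) powr (p - 1) * w)"
    using flux_inv_scale[OF p _ ab, of "c * \<omega>" w] c \<omega> by simp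
  ultimately show "((\<lambda>t. c * periodic2 (wave p a b) (\<omega> * t)) has_real_derivative
      flux_inv p a b ((c * \<omega>) powr (p - 1) * periodic2 (wave_flux p a b) (\<omega> * t))) (at t within {0..L})"
    by (simp add: w_def)
  have "((\<lambda>t. (c * \<omega>) powr (p - 1) * periodic2 (wave_flux p a b) (\<omega> * t)) has_real_derivative
      (c * \<omega>) powr (p - 1) * (- wave_eigenvalue p a b * (\<bar>u\<bar> powr (p - 2) * u) * \<omega>)) (at t within {0..L})"
    unfolding u_def by (intro DERIV_cmult DERIV_chain2[OF periodic_wave_derivative(2) lin])
  moreover have "(c * \<omega>) powr (p - 1) * (- wave_eigenvalue p a b * (\<bar>u\<bar> powr (p - 2) * u) * \<omega>)
      = - (\<omega> powr p * wave_eigenvalue p a b) * (\<bar>c * u\<bar> powr (p - 2) * (c * u))"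
  proof -
    have "c powr (p - 1) = c powr (p - 2) * c" "\<omega> powr p = \<omega> powr (p - 1) * \<omega>"
      using c \<omega> powr_add[of c "p - 2" 1] powr_add[of \<omega> "p - 1" 1] by (simp_all add: add.commute)
    then show ?thesis using c \<omega> by (simp add: powr_mult abs_mult)
  qed
  ultimately show "((\<lambda>t. (c * \<omega>) powr (p - 1) * periodic2 (wave_flux p a b) (\<omega> * t)) has_real_derivative
      - (\<omega> powr p * wave_eigenvalue p a b) * (\<bar>c * periodic2 (wave p a b) (\<omega> * t)\<bar> powr (p - 2)
        * (c * periodic2 (wave p a b) (\<omega> * t)))) (at t within {0..L})"
    unfolding u_def by (rule DERIV_cong)
qed

lemma wave_pos:
  assumes t: "0 < t" "t < 1"
  shows "wave p a b t > 0"
proof -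
  note t0 = t0_bounds[OF p ab]
  show ?thesis
  proof (cases "t \<le> t0_ab a b")
    case True
    then have "0 < t / t0_ab a b" "t / t0_ab a b \<le> 1" using t t0 by auto
    then have "0 < sin_p p (pi_p p / 2 * (t / t0_ab a b))" by (intro sin_p_pi_half_pos[OF p]) auto
    then show ?thesis
      using wave_pieces(1)[OF p ab, of t] True t by simp
  next
    case False
    then have "0 < (1 - t) / (1 - t0_ab a b)" "(1 - t) / (1 - t0_ab a b) \<le> 1" using t t0 by auto
    then have "0 < sin_p p (pi_p p / 2 * ((1 - t) / (1 - t0_ab a b)))"
      by (intro sin_p_pi_half_pos[OF p]) auto
    then show ?thesis
      using wave_pieces(2)[OF p ab, of t] False t t0 by simp
  qed
qed

end

section \<open>Shift by half a period and zeros of the wave\<close>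

lemma sin_p_pi_half_minus:
  assumes "p > 1" "\<bar>x\<bar> \<le> 1"
  shows "sin_p p (pi_p p / 2 * (- x)) = - sin_p p (pi_p p / 2 * x)"
proof -
  have "sin_p p (- (pi_p p / 2 * x)) = - sin_p p (pi_p p / 2 * x)"
    using assms by (intro sin_p_minus abs_pi_half_mult_le) auto
  then show ?thesis by simp
qed

lemma t0_ab_swap: "a > 0 \<Longrightarrow> b > 0 \<Longrightarrow> t0_ab b a = 1 - t0_ab a b"
  by (simp add: t0_ab_def field_simps)

text \<open>After time 1 the wave first falls with weight b and then rises with weight a; reflected,
  this is the positive arch for exchanged weights, whose turning point is 1 - t0.\<close>

lemma wave_half_period:
  assumes p: "p > 1" and ab: "a > 0" "b > 0" and r: "0 \<le> r" "r \<le> 1"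
  shows "wave p a b (r + 1) = - wave p b a r"
proof -
  define t0 where "t0 = t0_ab a b"
  have t0: "0 < t0" "t0 < 1" using t0_bounds[OF p ab] by (auto simp: t0_def)
  note w1 = wave_pieces[OF p ab, folded t0_def]
  note w2 = wave_pieces[OF p ab(2,1), unfolded t0_ab_swap[OF ab], folded t0_def]
  show ?thesis
  proof (cases "r \<le> 1 - t0")
    case True
    have "(1 - (r + 1)) / (1 - t0) = - (r / (1 - t0))" by (simp add: field_simps)
    moreover have "\<bar>r / (1 - t0)\<bar> \<le> 1" using True t0 r by simp
    ultimately show ?thesis
      using w1(2)[of "r + 1"] w2(1)[of r] True r t0 sin_p_pi_half_minus[OF p, of "r / (1 - t0)"] by simp
  next
    case False
    have "(r + 1 - 2) / t0 = - ((1 - r) / t0)" by (subst minus_divide_left) simp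
    moreover have "\<bar>(1 - r) / t0\<bar> \<le> 1" using False t0 r by simp
    ultimately show ?thesis
      using w1(3)[of "r + 1"] w2(2)[of r] False r t0 sin_p_pi_half_minus[OF p, of "(1 - r) / t0"] by simp
  qed
qed

lemma periodic_wave_half_period:
  assumes p: "p > 1" and ab: "a > 0" "b > 0"
  shows "periodic2 (wave p a b) (t - 1) = - periodic2 (wave p b a) t"
proof -
  define n where "n = \<lfloor>t / 2\<rfloor>"
  define r where "r = t - 2 * of_int n"
  have r: "0 \<le> r" "r < 2" using floor_correct[of "t / 2", folded n_def] unfolding r_def by linarith+
  have R: "periodic2 (wave p b a) t = wave p b a r" by (simp add: periodic2_def r_def n_def)
  show ?thesis
  proof (cases "r < 1")
    case True
    \<comment> \<open>In the first half of a period the shift by -1 leads into the previous period,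
      hence n - 1.\<close>
    have "periodic2 (wave p a b) (t - 1) = wave p a b (t - 1 - 2 * of_int (n - 1))"
      by (rule periodic2_eq) (use r True in \<open>auto simp: r_def\<close>)
    also have "t - 1 - 2 * of_int (n - 1) = r + 1" by (simp add: r_def)
    finally show ?thesis using wave_half_period[OF p ab, of r] r True by (simp add: R)
  next
    case False
    have "periodic2 (wave p a b) (t - 1) = wave p a b (t - 1 - 2 * of_int n)"
      by (rule periodic2_eq) (use r False in \<open>auto simp: r_def\<close>)
    also have "t - 1 - 2 * of_int n = r - 1" by (simp add: r_def)
    finally show ?thesis using wave_half_period[OF p ab(2,1), of "r - 1"] r False by (simp add: R)
  qed
qed

lemma periodic_wave_nat:
  assumes "p > 1" "a > 0" "b > 0"
  shows "periodic2 (wave p a b) (real k) = 0"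
proof -
  have k: "real k = 2 * real (k div 2) + real (k mod 2)"
    by (metis mult_div_mod_eq of_nat_add of_nat_mult of_nat_numeral)
  have "periodic2 (wave p a b) (real k) = wave p a b (real k - 2 * of_int (int (k div 2)))"
    by (rule periodic2_eq) (use k in auto)
  also have "real k - 2 * of_int (int (k div 2)) = real (k mod 2)" using k by simp
  finally show ?thesis
    using wave_integer_values[OF assms] by (cases "k mod 2 = 0") (auto simp: mod2_eq_if)
qed

text \<open>The wave is positive on (0, 1) and, by the half-period shift, negative on (1, 2), so
  only integers remain. Applied at \<omega> L, this quantises the frequency.\<close>

lemma periodic_wave_zeroD:
  assumes p: "p > 1" and ab: "a > 0" "b > 0" and t: "t > 0" and z: "periodic2 (wave p a b) t = 0"
  obtains k :: nat where "k \<ge> 1" "t = real k"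
proof -
  define n where "n = \<lfloor>t / 2\<rfloor>"
  define r where "r = t - 2 * of_int n"
  have r: "0 \<le> r" "r < 2" using floor_correct[of "t / 2", folded n_def] unfolding r_def by linarith+
  have n: "n \<ge> 0" using t by (simp add: n_def)
  have R: "wave p a b r = 0" using z by (simp add: periodic2_def r_def n_def)
  have "\<not> (0 < r \<and> r < 1)" using wave_pos[OF p ab, of r] R by auto
  moreover have "\<not> (1 < r)"
    using wave_half_period[OF p ab, of "r - 1"] wave_pos[OF p ab(2,1), of "r - 1"] r R by auto
  ultimately consider "r = 0" | "r = 1" using r by linarith
  then have "t = real (nat (2 * n)) \<or> t = real (nat (2 * n + 1))"
    using n by cases (auto simp: r_def)
  then obtain k where "t = real k" by blast
  with t that[of k] show ?thesis by (cases k) auto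
qed

section \<open>Classification of eigenfunctions\<close>

lemma asym_sol_cong:
  assumes "asym_sol p a b L lam u w" and eq: "\<And>t. t \<in> {0..L} \<Longrightarrow> v t = u t"
  shows "asym_sol p a b L lam v w"
  unfolding asym_sol_def
proof (intro ballI conjI)
  fix t assume t: "t \<in> {0..L}"
  have "(u has_real_derivative flux_inv p a b (w t)) (at t within {0..L})"
    using assms(1) t by (simp add: asym_sol_def)
  then show "(v has_real_derivative flux_inv p a b (w t)) (at t within {0..L})"
    by (rule has_field_derivative_transform_within[OF _ zero_less_one t]) (simp add: eq)
  show "(w has_real_derivative - lam * (\<bar>v t\<bar> powr (p - 2) * v t)) (at t within {0..L})"
    using assms(1) t by (simp add: asym_sol_def eq)
qed

lemma is_eigenfunction_iff_asym_sol:
  assumes "p > 1" "a > 0" "b > 0" "L > 0"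
  shows "is_eigenfunction p a b L lam u \<longleftrightarrow>
    (\<exists>w. asym_sol p a b L lam u w) \<and> u 0 = 0 \<and> u L = 0 \<and> (\<exists>t\<in>{0..L}. u t \<noteq> 0)"
proof
  assume "is_eigenfunction p a b L lam u"
  then obtain u' where u': "W01p p L u u'" "weak_eig_eq p a b L lam u u'" and nz: "\<exists>t\<in>{0..L}. u t \<noteq> 0"
    by (auto simp: is_eigenfunction_def)
  have "u 0 = (LBINT s:{0..0}. u' s)" "u L = 0"
    using u'(1) assms(4) by (auto simp: W01p_def)
  moreover have "(LBINT s:{0..0}. u' s) = 0"
    unfolding set_lebesgue_integral_def
  proof (rule integral_eq_zero_AE)
    show "AE s in lborel. indicator {0..0} s *\<^sub>R u' s = 0"
      using AE_lborel_singleton[of "0::real"] by eventually_elim (auto simp: indicator_def)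
  qed
  moreover obtain w where "asym_sol p a b L lam u w"
    using weak_solution_imp_asym_sol[OF assms u'] by blast
  ultimately show "(\<exists>w. asym_sol p a b L lam u w) \<and> u 0 = 0 \<and> u L = 0 \<and> (\<exists>t\<in>{0..L}. u t \<noteq> 0)"
    using nz by auto
next
  assume *: "(\<exists>w. asym_sol p a b L lam u w) \<and> u 0 = 0 \<and> u L = 0 \<and> (\<exists>t\<in>{0..L}. u t \<noteq> 0)"
  then obtain w where "asym_sol p a b L lam u w" by blast
  then obtain u' where "W01p p L u u'" "weak_eig_eq p a b L lam u u'"
    using asym_sol_imp_weak_solution[OF assms] * by blast
  then show "is_eigenfunction p a b L lam u"
    unfolding is_eigenfunction_def using * by blast
qed

lemma is_eigenfunction_minus:
  assumes "p > 1" "a > 0" "b > 0" "L > 0" "is_eigenfunction p a b L lam u"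
  shows "is_eigenfunction p b a L lam (\<lambda>t. - u t)"
  using assms(5) asym_sol_minus unfolding is_eigenfunction_iff_asym_sol[OF assms(1-4)]
    is_eigenfunction_iff_asym_sol[OF assms(1,3,2,4)] by fastforce

lemma is_eigenfunction_cong:
  assumes "p > 1" "a > 0" "b > 0" "L > 0" "is_eigenfunction p a b L lam u"
    and "\<And>t. t \<in> {0..L} \<Longrightarrow> v t = u t"
  shows "is_eigenfunction p a b L lam v"
  using assms(5) asym_sol_cong[of p a b L lam u _ v] assms(4,6)
  unfolding is_eigenfunction_iff_asym_sol[OF assms(1-4)] by auto

text \<open>Separates the frequency k/L from the eigenvalue of the unscaled wave.\<close>

lemma eigenvalue_eq_wave_eigenvalue:
  assumes "p > 1" "a > 0" "b > 0" "L > 0"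
  shows "(real k * (a + b) / 2) powr p * lambda_kp 1 p L = (real k / L) powr p * wave_eigenvalue p a b"
proof -
  note q = pi_p_pos[OF assms(1)]
  have "(real k * (a + b) / 2) powr p * (pi_p p / L) powr p = (real k * (a + b) / 2 * (pi_p p / L)) powr p"
    using assms q by (subst powr_mult) auto
  also have "real k * (a + b) / 2 * (pi_p p / L) = real k / L * (pi_p p / 2 * (a + b))"
    by (simp add: field_simps)
  also have "\<dots> powr p = (real k / L) powr p * (pi_p p / 2 * (a + b)) powr p"
    using assms q by (subst powr_mult) auto
  finally show ?thesis by (simp add: lambda_kp_def wave_eigenvalue_def)
qed

lemma is_eigenfunction_wave:
  assumes p: "p > 1" and ab: "a > 0" "b > 0" and L: "L > 0" and k: "k \<ge> 1" and c: "c > 0"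
  shows "is_eigenfunction p a b L ((real k * (a + b) / 2) powr p * lambda_kp 1 p L)
    (\<lambda>t. c * periodic2 (wave p a b) (real k * t / L))"
proof -
  have k0: "real k / L > 0" using k L by simp
  have sol: "asym_sol p a b L ((real k / L) powr p * wave_eigenvalue p a b)
      (\<lambda>t. c * periodic2 (wave p a b) (real k * t / L))
      (\<lambda>t. (c * (real k / L)) powr (p - 1) * periodic2 (wave_flux p a b) (real k * t / L))"
    using asym_sol_wave[OF p ab c k0, of L] by simp
  have z: "periodic2 (wave p a b) 0 = 0" "periodic2 (wave p a b) (real k) = 0"
    using periodic_wave_nat[OF p ab, of 0] periodic_wave_nat[OF p ab, of k] by auto
  \<comment> \<open>Nontriviality is tested at t = L/(2k), where the argument of the wave is 1/2,
    inside the first positive arch.\<close>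
  have "periodic2 (wave p a b) (1 / 2) = wave p a b (1 / 2)"
    using periodic2_eq[of 0 "1 / 2" "wave p a b"] by simp
  then have nz: "c * periodic2 (wave p a b) (real k * (L / (2 * real k)) / L) \<noteq> 0"
    using wave_pos[OF p ab, of "1 / 2"] k L c by simp
  have mem: "L / (2 * real k) \<in> {0..L}"
    using k L by (auto simp: field_simps)
  show ?thesis
    unfolding is_eigenfunction_iff_asym_sol[OF p ab L] eigenvalue_eq_wave_eigenvalue[OF p ab L]
    using sol z L nz mem by (intro conjI exI bexI[of _ "L / (2 * real k)"]) auto
qed

lemma asym_sol_classify_pos:
  assumes p: "p > 1" and ab: "a > 0" "b > 0" and L: "L > 0" and lam: "lam > 0"
    and sol: "asym_sol p a b L lam u w" and bc: "u 0 = 0" "u L = 0" and w0: "w 0 > 0"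
  shows "\<exists>k::nat. k \<ge> 1 \<and> lam = (real k * (a + b) / 2) powr p * lambda_kp 1 p L \<and>
    (\<exists>c>0. \<forall>t\<in>{0..L}. u t = c * periodic2 (wave p a b) (real k * t / L))"
proof -
  define E where "E = wave_eigenvalue p a b"
  have E: "E > 0" unfolding E_def by (rule wave_eigenvalue_pos[OF p ab])
  \<comment> \<open>The frequency is forced by lam, independently of the initial flux.\<close>
  define \<omega> where "\<omega> = (lam / E) powr (1 / p)"
  have \<omega>: "\<omega> > 0" using lam E by (simp add: \<omega>_def)
  have lam_eq: "lam = \<omega> powr p * E"
    using powr_inverse_cancel(2)[of p "lam / E"] p lam E by (simp add: \<omega>_def)
  define W where "W = periodic2 (wave_flux p a b) 0"
  have W: "W > 0"
    using wave_flux_end_values(1)[OF p ab] ab pi_p_pos[OF p] by (simp add: W_def periodic2_def)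
  \<comment> \<open>Solves (c \<omega>)^(p-1) W = w(0), so that the rescaled wave has the initial
    data of the given solution.\<close>
  define c where "c = (w 0 / W) powr (1 / (p - 1)) / \<omega>"
  have c: "c > 0" using w0 W \<omega> by (simp add: c_def)
  have wc: "w 0 = (c * \<omega>) powr (p - 1) * W"
    using powr_inverse_cancel(2)[of "p - 1" "w 0 / W"] p w0 W \<omega> by (simp add: c_def)
  have z: "periodic2 (wave p a b) 0 = 0" using periodic_wave_nat[OF p ab, of 0] by simp
  have u: "u t = c * periodic2 (wave p a b) (\<omega> * t)" if "t \<in> {0..L}" for t
  proof (rule asym_sol_unique[OF p ab lam sol _ _ _ _ that])
    show "asym_sol p a b L lam (\<lambda>t. c * periodic2 (wave p a b) (\<omega> * t))
        (\<lambda>t. (c * \<omega>) powr (p - 1) * periodic2 (wave_flux p a b) (\<omega> * t))"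
      unfolding lam_eq E_def by (rule asym_sol_wave[OF p ab c \<omega>])
  qed (use bc z wc w0 in \<open>auto simp: W_def\<close>)
  have "periodic2 (wave p a b) (\<omega> * L) = 0" using u[of L] bc L c by simp
  then obtain k :: nat where k: "k \<ge> 1" "\<omega> * L = real k"
    using periodic_wave_zeroD[OF p ab, of "\<omega> * L"] \<omega> L by auto
  then have \<omega>_eq: "\<omega> = real k / L" using L by (simp add: field_simps)
  have "lam = (real k * (a + b) / 2) powr p * lambda_kp 1 p L"
    unfolding eigenvalue_eq_wave_eigenvalue[OF p ab L] using lam_eq by (simp add: \<omega>_eq E_def)
  moreover have "\<forall>t\<in>{0..L}. u t = c * periodic2 (wave p a b) (real k * t / L)"
    using u by (simp add: \<omega>_eq)
  ultimately show ?thesis using k(1) c by auto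
qed

lemma is_eigenfunction_classify:
  assumes p: "p > 1" and ab: "a > 0" "b > 0" and L: "L > 0" and eig: "is_eigenfunction p a b L lam u"
  shows "\<exists>k::nat. k \<ge> 1 \<and> lam = (real k * (a + b) / 2) powr p * lambda_kp 1 p L \<and>
    (\<exists>c>0. (\<forall>t\<in>{0..L}. u t = c * periodic2 (wave p a b) (real k * t / L))
         \<or> (\<forall>t\<in>{0..L}. u t = c * periodic2 (wave p a b) (real k * t / L - 1)))"
proof -
  obtain w t1 where sol: "asym_sol p a b L lam u w" and bc: "u 0 = 0" "u L = 0"
    and t1: "t1 \<in> {0..L}" "u t1 \<noteq> 0"
    using eig unfolding is_eigenfunction_iff_asym_sol[OF p ab L] by auto
  have lam: "lam > 0" by (rule asym_sol_eigenvalue_pos[OF p ab L sol bc t1])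
  have "w 0 \<noteq> 0" using asym_sol_unique_zero[OF p ab sol lam bc(1) _ t1(1)] t1(2) by blast
  then consider "w 0 > 0" | "- w 0 > 0" by linarith
  then show ?thesis
  proof cases
    case 1
    from asym_sol_classify_pos[OF p ab L lam sol bc 1] show ?thesis by blast
  next
    case 2
    \<comment> \<open>The negated solution belongs to the exchanged weights. The eigenvalue depends
      on a and b only through a+b, and the half-period shift expresses the exchanged wave by the
      original one.\<close>
    have "\<exists>k::nat. k \<ge> 1 \<and> lam = (real k * (b + a) / 2) powr p * lambda_kp 1 p L \<and>
      (\<exists>c>0. \<forall>t\<in>{0..L}. - u t = c * periodic2 (wave p b a) (real k * t / L))"
      by (rule asym_sol_classify_pos[OF p ab(2,1) L lam asym_sol_minus[OF sol]]) (use bc 2 in auto)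
    then obtain k c where "k \<ge> 1" "lam = (real k * (a + b) / 2) powr p * lambda_kp 1 p L" "c > 0"
      and u: "\<forall>t\<in>{0..L}. - u t = c * periodic2 (wave p b a) (real k * t / L)"
      by (auto simp: add.commute)
    moreover have "\<forall>t\<in>{0..L}. u t = c * periodic2 (wave p a b) (real k * t / L - 1)"
      using u unfolding periodic_wave_half_period[OF p ab] by fastforce
    ultimately show ?thesis by blast
  qed
qed

text \<open>Classification only provides some index; injectivity identifies it with the index of the
  given eigenvalue.\<close>

lemma eigenvalue_inject:
  assumes "p > 1" "a > 0" "b > 0" "L > 0"
    and "(real k * (a + b) / 2) powr p * lambda_kp 1 p L = (real l * (a + b) / 2) powr p * lambda_kp 1 p L"
  shows "k = l"
proof -
  have "(real k / L) powr p = (real l / L) powr p"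
    using assms(5) wave_eigenvalue_pos[OF assms(1-3)]
    unfolding eigenvalue_eq_wave_eigenvalue[OF assms(1-4)] by simp
  then have "real k / L = real l / L"
    by (rule powr_base_inject[rotated 3]) (use assms in auto)
  then show ?thesis using assms(4) by simp
qed

lemma is_eigenfunction_iff_wave:
  assumes p: "p > 1" and ab: "a > 0" "b > 0" and L: "L > 0" and k: "k \<ge> 1"
  shows "is_eigenfunction p a b L ((real k * (a + b) / 2) powr p * lambda_kp 1 p L) u \<longleftrightarrow>
    (\<exists>c>0. (\<forall>t\<in>{0..L}. u t = c * periodic2 (wave p a b) (real k * t / L))
         \<or> (\<forall>t\<in>{0..L}. u t = c * periodic2 (wave p a b) (real k * t / L - 1)))"
    (is "?eig u \<longleftrightarrow> ?form")
proof
  assume "?eig u"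
  from is_eigenfunction_classify[OF p ab L this] eigenvalue_inject[OF p ab L]
  show ?form by metis
next
  assume ?form
  then obtain c where c: "c > 0" and
    "(\<forall>t\<in>{0..L}. u t = c * periodic2 (wave p a b) (real k * t / L))
      \<or> (\<forall>t\<in>{0..L}. u t = c * periodic2 (wave p a b) (real k * t / L - 1))" by blast
  then show "?eig u"
  proof (elim disjE)
    assume "\<forall>t\<in>{0..L}. u t = c * periodic2 (wave p a b) (real k * t / L)"
    then show ?thesis
      by (intro is_eigenfunction_cong[OF p ab L is_eigenfunction_wave[OF p ab L k c]]) auto
  next
    assume u: "\<forall>t\<in>{0..L}. u t = c * periodic2 (wave p a b) (real k * t / L - 1)"
    have "is_eigenfunction p a b L ((real k * (b + a) / 2) powr p * lambda_kp 1 p L)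
        (\<lambda>t. - (c * periodic2 (wave p b a) (real k * t / L)))"
      by (rule is_eigenfunction_minus[OF p ab(2,1) L is_eigenfunction_wave[OF p ab(2,1) L k c]])
    then have "?eig (\<lambda>t. - (c * periodic2 (wave p b a) (real k * t / L)))" by (simp add: add.commute)
    then show ?thesis
      by (rule is_eigenfunction_cong[OF p ab L]) (use u in \<open>simp add: periodic_wave_half_period[OF p ab]\<close>)
  qed
qed

section \<open>Identification with the normalised eigenfunction\<close>

lemma periodic2_Icc01: "0 \<le> t \<Longrightarrow> t \<le> 1 \<Longrightarrow> periodic2 f t = f t"
  using periodic2_eq[of 0 t f] by simp

lemma wave_norm_pos:
  assumes p: "p > 1"
  shows "(LBINT t:{0..1}. \<bar>wave p 1 1 t\<bar> powr p) > 0"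
proof -
  have "continuous_on {0..1} (wave p 1 1)"
    by (rule continuous_on_subset[OF continuous_on_wave[OF p]]) auto
  then have cont: "continuous_on {0..1} (\<lambda>t. \<bar>wave p 1 1 t\<bar> powr p)"
    by (intro continuous_on_powr' continuous_intros) (use p in auto)
  have eq: "(LBINT t:{0..1}. \<bar>wave p 1 1 t\<bar> powr p) = integral {0..1} (\<lambda>t. \<bar>wave p 1 1 t\<bar> powr p)"
    by (rule set_borel_integral_eq_integral(2), rule borel_integrable_atLeastAtMost'[OF cont])
  have "integral {0..1} (\<lambda>t. \<bar>wave p 1 1 t\<bar> powr p) \<noteq> 0"
  proof
    assume "integral {0..1} (\<lambda>t. \<bar>wave p 1 1 t\<bar> powr p) = 0"
    then have "\<forall>t\<in>{0..1}. \<bar>wave p 1 1 t\<bar> powr p = 0"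
      using integral_eq_0_iff[OF cont] by simp
    then show False using wave_pos[OF p, of 1 1 "1 / 2"] by force
  qed
  moreover have "integral {0..1} (\<lambda>t. \<bar>wave p 1 1 t\<bar> powr p) \<ge> 0"
    by (rule Henstock_Kurzweil_Integration.integral_nonneg) (auto intro: integrable_continuous_real cont)
  ultimately show ?thesis using eq by simp
qed

text \<open>The description operator is resolved by the classification for a = b = L = k = 1: there
  the shifted wave is the negative of the wave, positivity on (0, 1) excludes it, and the norm fixes
  the constant.\<close>

lemma varphi_p_eq:
  assumes p: "p > 1"
  obtains c where "c > 0" "\<And>t. varphi_p p t = (if t \<in> {0..1} then c * wave p 1 1 t else 0)"
proof -
  define N where "N = (LBINT t:{0..1}. \<bar>wave p 1 1 t\<bar> powr p)"
  have N: "N > 0" unfolding N_def by (rule wave_norm_pos[OF p])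
  define c where "c = N powr (- 1 / p)"
  have c: "c > 0" using N by (simp add: c_def)
  have norm: "(LBINT t:{0..1}. \<bar>u t\<bar> powr p) = d powr p * N"
    if "d > 0" "\<And>t. t \<in> {0..1} \<Longrightarrow> u t = d * wave p 1 1 t" for d u
  proof -
    have "(LBINT t:{0..1}. \<bar>u t\<bar> powr p) = (LBINT t:{0..1}. d powr p * \<bar>wave p 1 1 t\<bar> powr p)"
      by (rule set_lebesgue_integral_cong) (use that in \<open>auto simp: abs_mult powr_mult\<close>)
    then show ?thesis by (simp add: N_def)
  qed
  have cN: "c powr p * N = 1"
  proof -
    have "c powr p = N powr (- 1)" unfolding c_def powr_powr using p by simp
    then show ?thesis using N by (simp add: powr_minus)
  qed
  define U where "U t = (if t \<in> {0..1} then c * wave p 1 1 t else 0)" for t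
  let ?P = "\<lambda>u. is_eigenfunction p 1 1 1 (lambda_kp 1 p 1) u \<and> (\<forall>t\<in>{0<..<1}. u t > 0) \<and>
    (LBINT t:{0..1}. \<bar>u t\<bar> powr p) = 1 \<and> (\<forall>t. t \<notin> {0..1} \<longrightarrow> u t = 0)"
  have eig: "is_eigenfunction p 1 1 1 (lambda_kp 1 p 1) u \<longleftrightarrow>
    (\<exists>c>0. (\<forall>t\<in>{0..1}. u t = c * wave p 1 1 t)
         \<or> (\<forall>t\<in>{0..1}. u t = - (c * wave p 1 1 t)))" for u
    using is_eigenfunction_iff_wave[OF p, of 1 1 1 1 u]
    by (simp add: periodic_wave_half_period[OF p] periodic2_Icc01)
  have PU: "?P U"
  proof (intro conjI)
    show "is_eigenfunction p 1 1 1 (lambda_kp 1 p 1) U"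
      unfolding eig using c by (intro exI[of _ c]) (simp add: U_def)
    show "\<forall>t\<in>{0<..<1}. U t > 0" using c wave_pos[OF p, of 1 1] by (simp add: U_def)
    show "(LBINT t:{0..1}. \<bar>U t\<bar> powr p) = 1" using norm[of c U] c cN by (simp add: U_def)
    show "\<forall>t. t \<notin> {0..1} \<longrightarrow> U t = 0" by (simp add: U_def)
  qed
  have uniq: "u = U" if P: "?P u" for u
  proof -
    obtain d where d: "d > 0" and "(\<forall>t\<in>{0..1}. u t = d * wave p 1 1 t)
        \<or> (\<forall>t\<in>{0..1}. u t = - (d * wave p 1 1 t))" using P eig by blast
    moreover have "\<not> (\<forall>t\<in>{0..1}. u t = - (d * wave p 1 1 t))"
    proof
      assume "\<forall>t\<in>{0..1}. u t = - (d * wave p 1 1 t)"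
      then have "u (1 / 2) = - (d * wave p 1 1 (1 / 2))" by simp
      moreover have "u (1 / 2) > 0" using P by simp
      ultimately show False using wave_pos[OF p, of 1 1 "1 / 2"] d by (simp add: mult_less_0_iff)
    qed
    ultimately have u: "\<And>t. t \<in> {0..1} \<Longrightarrow> u t = d * wave p 1 1 t" by blast
    then have "d powr p * N = c powr p * N" using norm[OF d u] P cN by simp
    then have "d powr p = c powr p" using N by simp
    then have "d = c"
      by (rule powr_base_inject[rotated 3]) (use d c p in auto)
    then show ?thesis using u P by (auto simp: U_def)
  qed
  have "varphi_p p = U"
    unfolding varphi_p_def by (rule the_equality, rule PU, erule uniq)
  then show ?thesis using that[OF c] by (simp add: U_def)
qed

text \<open>Each half of \<open>varphi_p\<close> is a quarter of the symmetric wave, with phase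
  linear in t. Stretching the halves to lengths t0 and 1 - t0 yields exactly the asymmetric
  triangular phase.\<close>

lemma phi_ab_eq_wave:
  assumes p: "p > 1" and ab: "a > 0" "b > 0"
    and v: "\<And>t. varphi_p p t = (if t \<in> {0..1} then c * wave p 1 1 t else 0)"
  shows "phi_ab p a b t = c * periodic2 (wave p a b) t"
proof -
  define t0 where "t0 = t0_ab a b"
  have t0: "0 < t0" "t0 < 1" using t0_bounds[OF p ab] by (auto simp: t0_def)
  define s where "s = t - 2 * of_int \<lfloor>t / 2\<rfloor>"
  have s: "0 \<le> s" "s < 2" using floor_correct[of "t / 2"] unfolding s_def by linarith+
  define S where "S x = sin_p p (pi_p p / 2 * x)" for x
  have up: "varphi_p p x = c * S (2 * x)" if "0 \<le> x" "x \<le> 1 / 2" for x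
    using that wave_pieces(1)[OF p, of 1 1 x] by (simp add: v S_def t0_ab_def)
  have down: "varphi_p p x = c * S (2 * (1 - x))" if "1 / 2 \<le> x" "x \<le> 1" for x
    using that wave_pieces(2)[OF p, of 1 1 x] by (simp add: v S_def t0_ab_def mult.commute)
  have odd: "S (- x) = - S x" if "\<bar>x\<bar> \<le> 1" for x
    unfolding S_def by (rule sin_p_pi_half_minus[OF p that])
  note wp = wave_pieces[OF p ab, folded t0_def, folded S_def]
  have "phi_ab p a b t = (if s < 1 then varphi_plus p a b s else varphi_minus p a b (s - 1))"
    by (simp add: phi_ab_def s_def)
  also have "\<dots> = c * wave p a b s"
  proof -
    \<comment> \<open>Four quarters against three pieces of \<open>wave\<close>: the falling piece
      crosses zero at s = 1, where \<open>phi_ab\<close> passes from \<open>varphi_plus\<close> to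
      \<open>varphi_minus\<close>.\<close>
    consider "s < t0" | "t0 \<le> s" "s < 1" | "1 \<le> s" "s - 1 < 1 - t0" | "1 \<le> s" "1 - t0 \<le> s - 1"
      by linarith
    then show ?thesis
    proof cases
      case 1
      have "varphi_p p (s / (2 * t0)) = c * S (2 * (s / (2 * t0)))"
        by (rule up) (use 1 s t0 in \<open>auto simp: field_simps\<close>)
      moreover have "2 * (s / (2 * t0)) = s / t0" by simp
      ultimately show ?thesis using 1 s t0 wp(1)[of s] by (simp add: varphi_plus_def flip: t0_def)
    next
      case 2
      have "varphi_p p ((s + 1 - 2 * t0) / (2 * (1 - t0))) = c * S (2 * (1 - (s + 1 - 2 * t0) / (2 * (1 - t0))))"
        by (rule down) (use 2 t0 in \<open>auto simp: field_simps\<close>)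
      moreover have "2 * (1 - (s + 1 - 2 * t0) / (2 * (1 - t0))) = (1 - s) / (1 - t0)"
        using t0 by (simp add: field_simps)
      ultimately show ?thesis using 2 t0 wp(2)[of s] by (simp add: varphi_plus_def flip: t0_def)
    next
      case 3
      have "varphi_p p ((s - 1) / (2 * (1 - t0))) = c * S (2 * ((s - 1) / (2 * (1 - t0))))"
        by (rule up) (use 3 t0 in \<open>auto simp: field_simps\<close>)
      moreover have "2 * ((s - 1) / (2 * (1 - t0))) = (s - 1) / (1 - t0)"
        using t0 by (simp add: field_simps)
      moreover have "S (- ((s - 1) / (1 - t0))) = - S ((s - 1) / (1 - t0))"
        by (rule odd) (use 3 t0 in auto)
      moreover have "(1 - s) / (1 - t0) = - ((s - 1) / (1 - t0))" by (subst minus_divide_left) simp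
      ultimately show ?thesis using 3 t0 wp(2)[of s] by (simp add: varphi_minus_def flip: t0_def)
    next
      case 4
      have "varphi_p p ((s - 1 + 2 * t0 - 1) / (2 * t0)) = c * S (2 * (1 - (s - 1 + 2 * t0 - 1) / (2 * t0)))"
        by (rule down) (use 4 s t0 in \<open>auto simp: field_simps\<close>)
      moreover have "2 * (1 - (s - 1 + 2 * t0 - 1) / (2 * t0)) = (2 - s) / t0"
        using t0 by (simp add: field_simps)
      moreover have "S (- ((2 - s) / t0)) = - S ((2 - s) / t0)"
        by (rule odd) (use 4 s t0 in auto)
      moreover have "(s - 2) / t0 = - ((2 - s) / t0)" by (subst minus_divide_left) simp
      ultimately show ?thesis using 4 s t0 wp(3)[of s] by (simp add: varphi_minus_def flip: t0_def)
    qed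
  qed
  finally show ?thesis by (simp add: periodic2_def s_def)
qed

theorem theorem2:
  fixes p a b L :: real
  assumes "p > 1" and "a > 0" and "b > 0" and "L > 0"
  shows "asym_spectrum p a b L
           = {(real k * (a + b) / 2) powr p * lambda_kp 1 p L | k. k \<ge> 1}
       \<and> {(real k * (a + b) / 2) powr p * lambda_kp 1 p L | k. k \<ge> 1}
           = {((a + b) / 2) powr p * lambda_kp k p L | k. k \<ge> 1}
       \<and> (\<forall>k::nat. k \<ge> 1 \<longrightarrow> (\<forall>u. (\<exists>u'. W01p p L u u') \<longrightarrow>
            (is_eigenfunction p a b L ((real k * (a + b) / 2) powr p * lambda_kp 1 p L) u
             \<longleftrightarrow> (\<exists>c>0. (\<forall>t\<in>{0..L}. u t = c * phi_ab p a b (real k * t / L))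
                       \<or> (\<forall>t\<in>{0..L}. u t = c * phi_ab p a b (real k * t / L - 1))))))"
proof (intro conjI allI impI)
  show "asym_spectrum p a b L = {(real k * (a + b) / 2) powr p * lambda_kp 1 p L | k. k \<ge> 1}"
    unfolding asym_spectrum_def
    using is_eigenfunction_classify[OF assms] is_eigenfunction_wave[OF assms _ zero_less_one] by blast
  have "(real k * (a + b) / 2) powr p * lambda_kp 1 p L = ((a + b) / 2) powr p * lambda_kp k p L" for k
  proof -
    have "(real k * (a + b) / 2) powr p = real k powr p * ((a + b) / 2) powr p"
      using assms powr_mult[of "real k" "(a + b) / 2" p] by simp
    moreover have "(real k * pi_p p / L) powr p = real k powr p * (pi_p p / L) powr p"
      using assms pi_p_pos[OF assms(1)] powr_mult[of "real k" "pi_p p / L" p] by simp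
    ultimately show ?thesis by (simp add: lambda_kp_def)
  qed
  then show "{(real k * (a + b) / 2) powr p * lambda_kp 1 p L | k. k \<ge> 1}
      = {((a + b) / 2) powr p * lambda_kp k p L | k. k \<ge> 1}"
    by simp
next
  fix k :: nat and u
  assume k: "k \<ge> 1"
  obtain c0 where c0: "c0 > 0" and
    v: "\<And>t. varphi_p p t = (if t \<in> {0..1} then c0 * wave p 1 1 t else 0)"
    using varphi_p_eq[OF assms(1)] by blast
  note phi = phi_ab_eq_wave[OF assms(1-3) v]
  \<comment> \<open>The normalising constant of \<open>varphi_p\<close> is absorbed into the free
    positive factor.\<close>
  have scale: "(\<exists>c>0. Q (c * c0)) \<longleftrightarrow> (\<exists>c>0. Q c)" for Q :: "real \<Rightarrow> bool"
  proof
    assume "\<exists>c>0. Q c"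
    then obtain c where "c > 0" "Q c" by blast
    then show "\<exists>c>0. Q (c * c0)" using c0 by (intro exI[of _ "c / c0"]) auto
  next
    assume "\<exists>c>0. Q (c * c0)"
    then obtain c where "c > 0" "Q (c * c0)" by blast
    then show "\<exists>c>0. Q c" using c0 by (intro exI[of _ "c * c0"]) auto
  qed
  show "is_eigenfunction p a b L ((real k * (a + b) / 2) powr p * lambda_kp 1 p L) u
     \<longleftrightarrow> (\<exists>c>0. (\<forall>t\<in>{0..L}. u t = c * phi_ab p a b (real k * t / L))
               \<or> (\<forall>t\<in>{0..L}. u t = c * phi_ab p a b (real k * t / L - 1)))"
    unfolding is_eigenfunction_iff_wave[OF assms k] phi mult.assoc[symmetric]
    by (rule scale[symmetric])
qed

end
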